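(* Let $p$ be a prime, $q=p^e$, $m\ge1$, and let $C\subseteq\mathbb{F}_{q^m}^n$ be a linear code with a generator matrix $G=(g_{ij})_{i\in[k],\,j\in[n]}$ over $\mathbb{F}_{q^m}$. Let $\mathrm{Tr}_{q^m/q}(C)=\{(\mathrm{Tr}_{q^m/q}(c_1),\dots,\mathrm{Tr}_{q^m/q}(c_n)):(c_1,\dots,c_n)\in C\}$ be its trace code over $\mathbb{F}_q$. Then the $p$-adic valuation of $\mathrm{Tr}_{q^m/q}(C)$ is equal to the minimum, over all $\boldsymbol{r}=(r_1,\dots,r_k)\in[0,q^m-1]^k$ with $|\boldsymbol{r}|=\sum_i r_i\equiv0\pmod{q-1}$ and $|\boldsymbol{r}|>0$, of \[\frac{1}{p-1}\sum_{i=1}^k S_p(r_i)+\nu_p\Big(\sum_{j=1}^n\prod_{i=1}^k T(g_{ij})^{r_i}\Big)-e.\]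
   Context: A linear code over $\mathbb{F}_q$ is $\Delta$-divisible if the Hamming weight of each codeword is divisible by $\Delta$; its $p$-adic valuation is the greatest integer $t$ such that it is $p^t$-divisible. $[a,b]=\{i\in\mathbb{Z}:a\le i\le b\}$, $[k]=[1,k]$. $S_p(a)$ is the sum of the base-$p$ digits of $a$. $T:\mathbb{F}_{q^m}\to\mathbb{Z}_p[\xi_{q^m-1}]$ is the Teichmüller lift: $T(0)=0$ and $T$ maps $\mathbb{F}_{q^m}^\times$ to the $(q^m-1)$-st roots of unity as the inverse of reduction modulo $p$; the convention $T(0)^0=1$ is used. $\nu_p$ is the $p$-adic valuation extended to the relevant cyclotomic extension of $\mathbb{Q}_p$ (with $\nu_p(0)=\infty$). *)

theory Defs
  imports Complex_Main "HOL-Computational_Algebra.Primes" "HOL-Library.Extended_Real" "HOL-Library.Cardinality"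
begin

fun digit_sum :: "nat \<Rightarrow> nat \<Rightarrow> nat" where
  "digit_sum p a = (if p < 2 \<or> a = 0 then 0 else a mod p + digit_sum p (a div p))"

definition hweight :: "nat \<Rightarrow> (nat \<Rightarrow> 'a::zero) \<Rightarrow> nat" where
  "hweight n c = card {j. j < n \<and> c j \<noteq> 0}"

text \<open>p-adic valuation of a code: greatest t with all weights divisible by p^t
  (infinity if every weight is 0).\<close>
definition code_val :: "nat \<Rightarrow> nat \<Rightarrow> (nat \<Rightarrow> 'a::zero) set \<Rightarrow> ereal" where
  "code_val p n C = (SUP t \<in> {t::nat. \<forall>c\<in>C. p ^ t dvd hweight n c}. ereal (real t))"

definition lin_code :: "nat \<Rightarrow> nat \<Rightarrow> (nat \<Rightarrow> nat \<Rightarrow> 'a::field) \<Rightarrow> (nat \<Rightarrow> 'a) set" where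
  "lin_code k n G = {c. \<exists>x. \<forall>j. c j = (if j < n then (\<Sum>i<k. x i * G i j) else 0)}"

definition trace :: "nat \<Rightarrow> nat \<Rightarrow> 'a::field \<Rightarrow> 'a" where
  "trace q m x = (\<Sum>i<m. x ^ (q ^ i))"

definition trace_code :: "nat \<Rightarrow> nat \<Rightarrow> nat \<Rightarrow> (nat \<Rightarrow> 'a::field) set \<Rightarrow> (nat \<Rightarrow> 'a) set" where
  "trace_code q m n C = (\<lambda>c j. if j < n then trace q m (c j) else 0) ` C"

definition zeta :: "nat \<Rightarrow> complex" where
  "zeta N = cis (2 * pi / real N)"

definition Zring :: "nat \<Rightarrow> complex set" where
  "Zring N = {z. \<exists>a::nat \<Rightarrow> int. z = (\<Sum>k<N. of_int (a k) * zeta N ^ k)}"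

text \<open>A surjective ring homomorphism Z[zeta_N] -> F (reduction modulo a prime P above p
  with residue field F).\<close>
definition residue_map :: "nat \<Rightarrow> (complex \<Rightarrow> 'a::field) \<Rightarrow> bool" where
  "residue_map N \<phi> \<longleftrightarrow>
     (\<forall>x\<in>Zring N. \<forall>y\<in>Zring N. \<phi> (x + y) = \<phi> x + \<phi> y \<and> \<phi> (x * y) = \<phi> x * \<phi> y)
     \<and> \<phi> 1 = 1 \<and> \<phi> ` Zring N = UNIV"

definition teich :: "nat \<Rightarrow> (complex \<Rightarrow> 'a::field) \<Rightarrow> 'a \<Rightarrow> complex" where
  "teich N \<phi> a = (if a = 0 then 0 else THE z. (\<exists>j<N. z = zeta N ^ j) \<and> \<phi> z = a)"

text \<open>p-adic valuation (via the local ring at the prime P = ker phi, which is unramified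
  over p): nu x >= t iff s * x \<in> p^t Z[zeta] for some s \<notin> P.\<close>
definition nu :: "nat \<Rightarrow> nat \<Rightarrow> (complex \<Rightarrow> 'a::field) \<Rightarrow> complex \<Rightarrow> ereal" where
  "nu p N \<phi> x = (SUP t \<in> {t::nat. \<exists>s\<in>Zring N. \<phi> s \<noteq> 0 \<and>
        (\<exists>y\<in>Zring N. s * x = of_nat p ^ t * y)}. ereal (real t))"

end

theory Submission
  imports Defs "Jordan_Normal_Form.Char_Poly" "HOL-Number_Theory.Cong" "HOL-Library.FuncSet"
begin

text \<open>
  Write \<open>Q = p ^ d\<close> for the size of the field and \<open>N = Q - 1\<close>. Every function on \<open>F_Q ^ k\<close> is a unique
  combination of monomials in the Teichmueller representatives of the coordinates, with exponents
  in \<open>[0, N]\<close>, and passing between values and coefficients only divides by powers of the unit \<open>N\<close>. Hence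
  the smallest valuation of the values equals the smallest valuation of the coefficients. For
  the weight function of the trace code these coefficients are explicit: expanding an additive
  character \<open>\<psi>\<close> into Teichmueller monomials, with coefficients \<open>C s\<close> that are Gauss sums up to units, and
  counting zeros of the trace by \<open>\<Sum>a \<in> F_q. \<psi> (a y)\<close> gives
  \<open>- (q - 1) / q * (\<Prod>i. C (r i)) * (\<Sum>j. \<Prod>i. T (G i j) ^ r i)\<close>
  if \<open>q - 1\<close> divides \<open>|r| > 0\<close>, and \<open>0\<close> otherwise. By Stickelberger, \<open>C s\<close> has valuation
  \<open>digit_sum p s / (p - 1)\<close>.
\<close>

text \<open>No p-adic field is built: \<open>nu\<close> is read off from denominators outside the
  kernel of \<open>\<phi>\<close> in \<open>Zring N\<close>, where p is unramified. The coefficients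
  \<open>C s\<close> force the larger ring \<open>Zring (N * p)\<close>, in which p is, up to a
  local unit, the (p - 1)-st power of \<open>1 - zeta p\<close>. All valuations there are normalised
  by this element, so that \<open>p ^ t\<close> has value (p - 1) t and \<open>C s\<close> has the
  digit sum itself as its value, without a fraction. Returning to \<open>nu\<close> requires p - 1
  to divide the total digit sum of r; this follows from q - 1 dividing |r|. The minimum of a set of
  valuations is never formed. For each threshold t, all weights reach t iff all coefficients reach
  it; the supremum over t is taken only at the end. The term - e comes from expanding - q times the
  weight instead of the weight.\<close>

declare digit_sum.simps [simp del]

section \<open>Base-p digit sums\<close>

lemma digit_sum_0 [simp]: "digit_sum p 0 = 0"
  by (simp add: digit_sum.simps)

lemma digit_sum_rec: "p \<ge> 2 \<Longrightarrow> digit_sum p a = a mod p + digit_sum p (a div p)"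
  by (cases "a = 0") (simp_all add: digit_sum.simps[of p a])

lemma digit_sum_mult_add:
  assumes "b < p" "p \<ge> 2"
  shows "digit_sum p (p * a + b) = digit_sum p a + b"
  using assms by (subst digit_sum_rec) auto

lemma digit_sum_mult:
  assumes "p \<ge> 2"
  shows "digit_sum p (p * a) = digit_sum p a"
  using digit_sum_mult_add[of 0 p a] assms by simp

lemma digit_sum_1:
  assumes "p \<ge> 2"
  shows "digit_sum p (Suc 0) = 1"
  using digit_sum_mult_add[of 1 p 0] assms by simp

text \<open>The last digit of \<open>a\<close> is not p - 1, so adding 1 causes no carry.\<close>

lemma digit_sum_Suc:
  assumes "p \<ge> 2" "\<not> p dvd Suc a"
  shows "digit_sum p (Suc a) = Suc (digit_sum p a)"
proof -
  have "Suc (a mod p) \<noteq> p" using assms(2) by (metis mod_Suc mod_0_imp_dvd)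
  then have lt: "Suc (a mod p) < p"
    using assms(1) by (metis Suc_lessI less_le_trans mod_less_divisor pos2)
  have "digit_sum p (Suc a) = digit_sum p (p * (a div p) + Suc (a mod p))" by simp
  also have "\<dots> = digit_sum p (a div p) + Suc (a mod p)"
    using lt assms(1) by (rule digit_sum_mult_add)
  also have "\<dots> = Suc (digit_sum p a)" using assms(1) by (simp add: digit_sum_rec[of p a])
  finally show ?thesis .
qed

text \<open>All d digits of p^d - 1 are p - 1, so the subtraction never borrows and replaces each
  digit b by p - 1 - b.\<close>

lemma digit_sum_complement:
  assumes "p \<ge> 2" "s < p ^ d"
  shows "digit_sum p (p ^ d - 1 - s) + digit_sum p s = (p - 1) * d"
  using assms(2)
proof (induction d arbitrary: s)
  case (Suc d)
  define a b where "a = s div p" and "b = s mod p"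
  have s: "s = p * a + b" by (simp add: a_def b_def)
  have b: "b < p" using assms(1) by (simp add: b_def)
  have a: "a < p ^ d"
    using Suc.prems assms(1) by (simp add: a_def less_mult_imp_div_less mult.commute)
  have "p * (p ^ d - 1 - a) + p * a + p = p * (p ^ d - 1 - a + a + 1)" by (simp add: algebra_simps)
  also have "p ^ d - 1 - a + a + 1 = p ^ d" using a by simp
  also have "p * p ^ d = p ^ Suc d" by simp
  finally have "p ^ Suc d - 1 - s = p * (p ^ d - 1 - a) + (p - 1 - b)" using s b by simp
  then have "digit_sum p (p ^ Suc d - 1 - s) = digit_sum p (p ^ d - 1 - a) + (p - 1 - b)"
    using assms(1) by (simp only: digit_sum_mult_add)
  moreover have "digit_sum p s = digit_sum p a + b"
    unfolding s by (rule digit_sum_mult_add) (use b assms in auto)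
  moreover have "(p - 1) * Suc d = (p - 1) + (p - 1) * d" by simp
  ultimately show ?case using Suc.IH[OF a] b by linarith
qed simp

text \<open>Holds because p is 1 modulo p - 1. It later makes the total digit sum of an admissible
  exponent vector a multiple of p - 1.\<close>

lemma digit_sum_cong:
  assumes "p \<ge> 2"
  shows "[digit_sum p a = a] (mod (p - 1))"
proof (induction a rule: less_induct)
  case (less a)
  show ?case
  proof (cases "a = 0")
    case False
    then have "[digit_sum p (a div p) = a div p] (mod (p - 1))" using less assms by simp
    then have "[a mod p + digit_sum p (a div p) = a mod p + 1 * (a div p)] (mod (p - 1))"
      by (simp add: cong_add_lcancel_nat)
    also have "[a mod p + 1 * (a div p) = a mod p + p * (a div p)] (mod (p - 1))"
    proof -
      have "p * (a div p) = 1 * (a div p) + (p - 1) * (a div p)"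
        using assms by (metis add.commute distrib_right le_add_diff_inverse2 one_le_numeral order_trans)
      then show ?thesis by (simp add: cong_def flip: add.assoc)
    qed
    finally show ?thesis using assms by (simp add: digit_sum_rec[of p a])
  qed simp
qed

section \<open>Frobenius and the binomial theorem at a prime exponent\<close>

text \<open>Keeping the cofactor of p explicit lets one identity serve in characteristic p, for
  congruences modulo p in cyclotomic rings, and for expanding
  \<open>(1 - \<pi>) ^ p\<close>.\<close>

lemma prime_binomial_expansion:
  fixes x y :: "'a::comm_semiring_1"
  assumes "prime p"
  shows "(x + y) ^ p = x ^ p + y ^ p +
    of_nat p * (\<Sum>k\<in>{1..<p}. of_nat ((p choose k) div p) * x ^ k * y ^ (p - k))"
proof -
  have p: "p > 1" using assms by (rule prime_gt_1_nat)
  have "(x + y) ^ p = (\<Sum>k\<in>{0..p}. of_nat (p choose k) * x ^ k * y ^ (p - k))"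
    by (simp add: binomial_ring atLeast0AtMost)
  also have "{0..p} = insert 0 (insert p {1..<p})" using p by auto
  also have "(\<Sum>k\<in>insert 0 (insert p {1..<p}). of_nat (p choose k) * x ^ k * y ^ (p - k)) =
     y ^ p + (x ^ p + (\<Sum>k\<in>{1..<p}. of_nat (p choose k) * x ^ k * y ^ (p - k)))"
    using p by simp
  also have "(\<Sum>k\<in>{1..<p}. of_nat (p choose k) * x ^ k * y ^ (p - k)) =
     (\<Sum>k\<in>{1..<p}. of_nat p * (of_nat ((p choose k) div p) * x ^ k * y ^ (p - k)))"
  proof (rule sum.cong)
    fix k assume "k \<in> {1..<p}"
    then have "p dvd (p choose k)" using assms by (intro dvd_choose_prime) auto
    then have "(of_nat (p choose k) :: 'a) = of_nat p * of_nat ((p choose k) div p)"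
      by (metis dvd_mult_div_cancel of_nat_mult)
    then show "of_nat (p choose k) * x ^ k * y ^ (p - k) =
       of_nat p * (of_nat ((p choose k) div p) * x ^ k * y ^ (p - k))" by (simp add: mult_ac)
  qed simp
  finally show ?thesis by (simp add: sum_distrib_left add_ac)
qed

lemma char_power_add:
  fixes x y :: "'a::comm_semiring_1"
  assumes "prime p" "of_nat p = (0::'a)"
  shows "(x + y) ^ (p ^ i) = x ^ (p ^ i) + y ^ (p ^ i)"
proof (induction i)
  case (Suc i)
  have "(x + y) ^ (p ^ Suc i) = ((x + y) ^ (p ^ i)) ^ p" by (simp add: mult.commute flip: power_mult)
  also have "\<dots> = (x ^ (p ^ i)) ^ p + (y ^ (p ^ i)) ^ p"
    using assms by (simp add: Suc prime_binomial_expansion)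
  finally show ?case by (simp add: mult.commute flip: power_mult)
qed simp

lemma char_power_sum:
  fixes f :: "'b \<Rightarrow> 'a::comm_semiring_1"
  assumes "prime p" "of_nat p = (0::'a)"
  shows "(\<Sum>j\<in>J. f j) ^ (p ^ i) = (\<Sum>j\<in>J. f j ^ (p ^ i))"
proof -
  have "p ^ i \<noteq> 0" using assms(1) by (simp add: prime_gt_0_nat)
  then have "(0::'a) ^ (p ^ i) = 0" by (simp add: zero_power)
  then show ?thesis using assms by (induction J rule: infinite_finite_induct) (auto simp: char_power_add)
qed

section \<open>Discrete valuations without localisation\<close>

locale subring_set =
  fixes A :: "'b::comm_ring_1 set"
  assumes one_mem [simp]: "1 \<in> A"
    and add_mem: "x \<in> A \<Longrightarrow> y \<in> A \<Longrightarrow> x + y \<in> A"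
    and uminus_mem: "x \<in> A \<Longrightarrow> - x \<in> A"
    and mult_mem: "x \<in> A \<Longrightarrow> y \<in> A \<Longrightarrow> x * y \<in> A"
begin

lemma zero_mem [simp]: "0 \<in> A"
  using add_mem[OF one_mem uminus_mem[OF one_mem]] by simp

lemma diff_mem: "x \<in> A \<Longrightarrow> y \<in> A \<Longrightarrow> x - y \<in> A"
  using add_mem[of x "- y"] uminus_mem[of y] by simp

lemma power_mem: "x \<in> A \<Longrightarrow> x ^ n \<in> A"
  by (induction n) (auto intro: mult_mem)

lemma sum_mem: "(\<And>i. i \<in> I \<Longrightarrow> h i \<in> A) \<Longrightarrow> (\<Sum>i\<in>I. h i) \<in> A"
  by (induction I rule: infinite_finite_induct) (auto intro: add_mem)

lemma prod_mem: "(\<And>i. i \<in> I \<Longrightarrow> h i \<in> A) \<Longrightarrow> (\<Prod>i\<in>I. h i) \<in> A"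
  by (induction I rule: infinite_finite_induct) (auto intro: mult_mem)

lemma of_nat_mem [simp]: "of_nat n \<in> A"
  by (induction n) (auto intro: add_mem)

end

text \<open>\<open>u\<close> generates the prime ideal \<open>f = 0\<close> of \<open>A\<close> after localising at that prime. In terms of the
  associated valuation \<open>v\<close>, \<open>vge t x\<close> says \<open>v x \<ge> t\<close> and \<open>veq t x\<close> says \<open>v x = t\<close>. Elements \<open>x \<noteq> 0\<close>
  of infinite valuation are not excluded; the products that matter divide a power of \<open>p\<close>, which
  makes their factors finite by \<open>veq_factors\<close>.\<close>

locale uniformized = subring_set A for A :: "'b::field set" +
  fixes f :: "'b \<Rightarrow> 'a::field" and u :: 'b
  assumes hom_add: "x \<in> A \<Longrightarrow> y \<in> A \<Longrightarrow> f (x + y) = f x + f y"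
    and hom_mult: "x \<in> A \<Longrightarrow> y \<in> A \<Longrightarrow> f (x * y) = f x * f y"
    and hom_one [simp]: "f 1 = 1"
    and u_mem [simp]: "u \<in> A" and u_nz [simp]: "u \<noteq> 0" and hom_u [simp]: "f u = 0"
    and divide_u: "x \<in> A \<Longrightarrow> f x = 0 \<Longrightarrow> \<exists>s\<in>A. f s \<noteq> 0 \<and> (\<exists>y\<in>A. s * x = u * y)"
begin

lemma hom_zero [simp]: "f 0 = 0"
  using hom_add[of 0 0] by (metis add_cancel_right_right add_0 zero_mem)

lemma hom_power: "x \<in> A \<Longrightarrow> f (x ^ n) = f x ^ n"
  by (induction n) (auto simp: hom_mult power_mem)

lemma hom_sum: "(\<And>i. i \<in> I \<Longrightarrow> h i \<in> A) \<Longrightarrow> f (\<Sum>i\<in>I. h i) = (\<Sum>i\<in>I. f (h i))"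
  by (induction I rule: infinite_finite_induct) (auto simp: hom_add sum_mem)

lemma hom_of_nat [simp]: "f (of_nat n) = of_nat n"
  by (induction n) (auto simp: hom_add)

lemma hom_uminus: "x \<in> A \<Longrightarrow> f (- x) = - f x"
  using hom_add[of x "- x"] uminus_mem[of x] by (simp add: eq_neg_iff_add_eq_0 add.commute)

lemma hom_diff: "x \<in> A \<Longrightarrow> y \<in> A \<Longrightarrow> f (x - y) = f x - f y"
  using hom_add[of x "- y"] uminus_mem[of y] by (simp add: hom_uminus)

definition vge :: "nat \<Rightarrow> 'b \<Rightarrow> bool" where
  "vge t x \<longleftrightarrow> (\<exists>s\<in>A. f s \<noteq> 0 \<and> (\<exists>y\<in>A. s * x = u ^ t * y))"

definition veq :: "nat \<Rightarrow> 'b \<Rightarrow> bool" where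
  "veq t x \<longleftrightarrow> (\<exists>s\<in>A. f s \<noteq> 0 \<and> (\<exists>y\<in>A. f y \<noteq> 0 \<and> s * x = u ^ t * y))"

lemma vgeI: "x \<in> A \<Longrightarrow> vge t (u ^ t * x)"
  unfolding vge_def by (intro bexI[of _ 1]) auto

lemma vge_0I: "x \<in> A \<Longrightarrow> vge 0 x"
  using vgeI[of x 0] by simp

lemma vge_zero [simp]: "vge t 0"
  using vgeI[of 0 t] by simp

lemma veqI: "x \<in> A \<Longrightarrow> f x \<noteq> 0 \<Longrightarrow> veq t (u ^ t * x)"
  unfolding veq_def by (intro bexI[of _ 1]) auto

lemma veq_0I: "x \<in> A \<Longrightarrow> f x \<noteq> 0 \<Longrightarrow> veq 0 x"
  using veqI[of x 0] by simp

lemma veq_imp_vge: "veq t x \<Longrightarrow> vge t x"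
  unfolding veq_def vge_def by blast

lemma vge_mult:
  assumes "vge t x" "vge t' x'"
  shows "vge (t + t') (x * x')"
proof -
  obtain s y s' y' where *: "s \<in> A" "f s \<noteq> 0" "y \<in> A" "s * x = u ^ t * y"
    "s' \<in> A" "f s' \<noteq> 0" "y' \<in> A" "s' * x' = u ^ t' * y'"
    using assms unfolding vge_def by metis
  have "(s * s') * (x * x') = (s * x) * (s' * x')" by (simp add: mult_ac)
  also have "\<dots> = u ^ (t + t') * (y * y')" unfolding * by (simp add: power_add mult_ac)
  finally show ?thesis unfolding vge_def
    using * by (intro bexI[of _ "s * s'"]) (auto simp: hom_mult mult_mem)
qed

lemma veq_mult:
  assumes "veq t x" "veq t' x'"
  shows "veq (t + t') (x * x')"
proof -
  obtain s y s' y' where *: "s \<in> A" "f s \<noteq> 0" "y \<in> A" "f y \<noteq> 0" "s * x = u ^ t * y"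
    "s' \<in> A" "f s' \<noteq> 0" "y' \<in> A" "f y' \<noteq> 0" "s' * x' = u ^ t' * y'"
    using assms unfolding veq_def by metis
  have "(s * s') * (x * x') = (s * x) * (s' * x')" by (simp add: mult_ac)
  also have "\<dots> = u ^ (t + t') * (y * y')" unfolding * by (simp add: power_add mult_ac)
  finally show ?thesis unfolding veq_def using *
    by (intro bexI[of _ "s * s'"] conjI bexI[of _ "y * y'"]) (auto simp: hom_mult mult_mem)
qed

lemma veq_one: "veq 0 1"
  by (rule veq_0I) auto

lemma veq_prod: "(\<And>i. i \<in> I \<Longrightarrow> veq (t i) (h i)) \<Longrightarrow> veq (\<Sum>i\<in>I. t i) (\<Prod>i\<in>I. h i)"
  by (induction I rule: infinite_finite_induct) (auto intro: veq_mult veq_one)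

lemma veq_power: "veq t x \<Longrightarrow> veq (t * n) (x ^ n)"
  by (induction n) (auto intro: veq_mult veq_one)

lemma vge_prod_0: "(\<And>i. i \<in> I \<Longrightarrow> vge 0 (h i)) \<Longrightarrow> vge 0 (\<Prod>i\<in>I. h i)"
  by (induction I rule: infinite_finite_induct) (use vge_mult[of 0 _ 0] in \<open>auto intro: vge_0I\<close>)

lemma vge_add:
  assumes "vge t x" "vge t x'"
  shows "vge t (x + x')"
proof -
  obtain s y s' y' where *: "s \<in> A" "f s \<noteq> 0" "y \<in> A" "s * x = u ^ t * y"
    "s' \<in> A" "f s' \<noteq> 0" "y' \<in> A" "s' * x' = u ^ t * y'"
    using assms unfolding vge_def by metis
  have "(s * s') * (x + x') = s' * (s * x) + s * (s' * x')" by (simp add: algebra_simps)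
  also have "\<dots> = u ^ t * (s' * y + s * y')" unfolding * by (simp add: algebra_simps)
  finally show ?thesis unfolding vge_def
    using * by (intro bexI[of _ "s * s'"]) (auto simp: hom_mult mult_mem add_mem)
qed

lemma vge_sum: "(\<And>i. i \<in> I \<Longrightarrow> vge t (h i)) \<Longrightarrow> vge t (\<Sum>i\<in>I. h i)"
  by (induction I rule: infinite_finite_induct) (auto intro: vge_add)

lemma vge_mult_left: "vge 0 x \<Longrightarrow> vge t y \<Longrightarrow> vge t (x * y)"
  using vge_mult[of 0 x t y] by simp

lemma vge_uminus_iff: "vge t (- x) \<longleftrightarrow> vge t x"
  using vge_mult_left[of "-1" t x] vge_mult_left[of "-1" t "-x"] vge_0I[OF uminus_mem[OF one_mem]]
  by auto

lemma vge_mono: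
  assumes "vge t x" "t' \<le> t" shows "vge t' x"
proof -
  obtain s y where *: "s \<in> A" "f s \<noteq> 0" "y \<in> A" "s * x = u ^ t * y"
    using assms unfolding vge_def by metis
  have "u ^ t = u ^ t' * u ^ (t - t')" using assms(2) by (simp flip: power_add)
  then have "s * x = u ^ t' * (u ^ (t - t') * y)" using *(4) by simp
  then show ?thesis unfolding vge_def using * by (blast intro: mult_mem power_mem u_mem)
qed

text \<open>If n > t, cross-multiplying the two representations and cancelling \<open>u ^ t\<close>
  makes \<open>s' * y\<close> a multiple of \<open>u\<close>, although its image is a product of
  nonzero elements of a field.\<close>

lemma veq_vge_iff:
  assumes "veq t x" shows "vge n x \<longleftrightarrow> n \<le> t"
proof
  assume "vge n x"
  show "n \<le> t"
  proof (rule ccontr)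
    assume "\<not> n \<le> t"
    then have lt: "t < n" by simp
    obtain s y where *: "s \<in> A" "f s \<noteq> 0" "y \<in> A" "f y \<noteq> 0" "s * x = u ^ t * y"
      using assms unfolding veq_def by metis
    obtain s' y' where **: "s' \<in> A" "f s' \<noteq> 0" "y' \<in> A" "s' * x = u ^ n * y'"
      using \<open>vge n x\<close> unfolding vge_def by metis
    have un: "u ^ n = u ^ t * (u * u ^ (n - t - 1))" using lt by (simp flip: power_add power_Suc)
    have "u ^ t * (s' * y) = s' * (s * x)" by (simp add: * mult_ac)
    also have "\<dots> = s * (s' * x)" by (simp add: mult_ac)
    also have "\<dots> = u ^ t * (u * (u ^ (n - t - 1) * (s * y')))" unfolding ** un by (simp add: mult_ac)
    finally have "s' * y = u * (u ^ (n - t - 1) * (s * y'))" by simp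
    then have "f (s' * y) = f u * f (u ^ (n - t - 1) * (s * y'))"
      using * ** by (simp add: hom_mult mult_mem power_mem)
    then show False using * ** by (simp add: hom_mult)
  qed
next
  show "n \<le> t \<Longrightarrow> vge n x" using assms veq_imp_vge vge_mono by blast
qed

text \<open>If the numerator reduces to 0, \<open>divide_u\<close> extracts one more factor
  \<open>u\<close>; otherwise it is a local unit and the exponent is exact.\<close>

lemma vge_Suc_or_veq:
  assumes "vge t x" shows "vge (Suc t) x \<or> veq t x"
proof -
  obtain s y where *: "s \<in> A" "f s \<noteq> 0" "y \<in> A" "s * x = u ^ t * y"
    using assms unfolding vge_def by metis
  show ?thesis
  proof (cases "f y = 0")
    case True
    then obtain s' y' where **: "s' \<in> A" "f s' \<noteq> 0" "y' \<in> A" "s' * y = u * y'"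
      using divide_u[OF *(3)] by metis
    have "(s' * s) * x = u ^ t * (s' * y)" using * by (simp add: mult_ac)
    also have "\<dots> = u ^ Suc t * y'" by (simp add: **)
    finally have "vge (Suc t) x" unfolding vge_def using * **
      by (intro bexI[of _ "s' * s"]) (auto simp: hom_mult mult_mem)
    then show ?thesis ..
  next
    case False
    then show ?thesis unfolding veq_def using * by blast
  qed
qed

lemma veq_or_vge_all:
  assumes "vge 0 x" shows "(\<exists>t. veq t x) \<or> (\<forall>t. vge t x)"
proof (rule disjCI)
  assume "\<not> (\<forall>t. vge t x)"
  then obtain t where "\<not> vge t x" by blast
  then show "\<exists>t. veq t x"
  proof (induction t)
    case (Suc t)
    then show ?case using vge_Suc_or_veq[of t x] by blast
  qed (use assms in simp)
qed

lemma veq_cancel_unit: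
  assumes "veq t (s * x)" "s \<in> A" "f s \<noteq> 0" shows "veq t x"
proof -
  obtain s' y where "s' \<in> A" "f s' \<noteq> 0" "y \<in> A" "f y \<noteq> 0" "s' * (s * x) = u ^ t * y"
    using assms(1) unfolding veq_def by metis
  then show ?thesis unfolding veq_def using assms
    by (intro bexI[of _ "s' * s"] conjI bexI[of _ y]) (auto simp: hom_mult mult_mem mult.assoc)
qed

lemma veq_unique: "veq t x \<Longrightarrow> veq t' x \<Longrightarrow> t = t'"
  by (meson veq_vge_iff le_antisym order_refl)

text \<open>A factor divisible by all powers of \<open>u\<close> would make the product divisible by
  \<open>u ^ Suc n\<close>. This gives Gauss sums a finite valuation before it is computed.\<close>

lemma veq_factors:
  assumes "veq n (x * y)" "vge 0 x" "vge 0 y"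
  obtains a b where "veq a x" "veq b y" "a + b = n"
proof -
  have "\<not> (\<forall>t. vge t x)"
    using vge_mult[of "Suc n" x 0 y] assms veq_vge_iff[OF assms(1), of "Suc n"] by auto
  moreover have "\<not> (\<forall>t. vge t y)"
    using vge_mult[of 0 x "Suc n" y] assms veq_vge_iff[OF assms(1), of "Suc n"] by auto
  ultimately obtain a b where "veq a x" "veq b y" using assms veq_or_vge_all by blast
  with veq_mult veq_unique assms(1) that show ?thesis by blast
qed

end

section \<open>Cyclotomic integers\<close>

lemma zeta_power: "zeta N ^ k = cis (2 * pi * (real k / real N))"
  by (simp add: zeta_def DeMoivre mult_ac)

lemma zeta_power_N [simp]: "zeta N ^ N = 1"
  by (cases "N = 0") (simp_all add: zeta_power)

lemma zeta_power_mod: "zeta N ^ (k mod N) = zeta N ^ k"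
proof -
  have "zeta N ^ k = zeta N ^ (N * (k div N) + k mod N)" by simp
  also have "\<dots> = zeta N ^ (k mod N)" unfolding power_add power_mult by simp
  finally show ?thesis ..
qed

lemma zeta_power_cong: "[k = l] (mod N) \<Longrightarrow> zeta N ^ k = zeta N ^ l"
  by (metis zeta_power_mod cong_def)

lemma zeta_power_eq_iff:
  assumes "N > 0" shows "zeta N ^ k = zeta N ^ l \<longleftrightarrow> [k = l] (mod N)"
proof
  assume "zeta N ^ k = zeta N ^ l"
  then have "cis (2 * pi * real (k mod N) / real N) = cis (2 * pi * real (l mod N) / real N)"
    by (metis zeta_power zeta_power_mod times_divide_eq_right)
  moreover have "inj_on (\<lambda>k. cis (2 * pi * real k / real N)) {..<N}"
    using bij_betw_roots_unity[OF assms] by (rule bij_betw_imp_inj_on)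
  ultimately show "[k = l] (mod N)" using assms unfolding cong_def inj_on_def by auto
qed (rule zeta_power_cong)

lemma zeta_power_eq_1_iff: "N > 0 \<Longrightarrow> zeta N ^ k = 1 \<longleftrightarrow> N dvd k"
  using zeta_power_eq_iff[of N k 0] by (simp add: cong_0_iff)

lemma zeta_mult_power:
  assumes "N > 0" "p > 0"
  shows "zeta (N * p) ^ p = zeta N" "zeta (N * p) ^ N = zeta p"
  using assms by (simp_all add: zeta_power, simp_all add: zeta_def)

lemma sum_root_of_unity:
  fixes z :: "'a::field"
  assumes "z ^ n = 1" "z \<noteq> 1" shows "(\<Sum>i<n. z ^ i) = 0"
  using assms by (simp add: geometric_sum)

lemma ZringI: "x = (\<Sum>k<N. of_int (a k) * zeta N ^ k) \<Longrightarrow> x \<in> Zring N"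
  unfolding Zring_def by blast

text \<open>\<open>Zring\<close> admits only exponents below N; arbitrary exponents are folded
  modulo N by collecting coefficients.\<close>

lemma Zring_sum: "(\<Sum>i\<in>I. of_int (a i) * zeta N ^ h i) \<in> Zring N" if "N > 0" "finite I" for I :: "'i set"
proof -
  have "(\<Sum>i\<in>I. of_int (a i) * zeta N ^ h i) =
     (\<Sum>i\<in>I. \<Sum>k<N. if k = h i mod N then of_int (a i) * zeta N ^ k else 0)"
    using that by (intro sum.cong) (auto simp: zeta_power_mod)
  also have "\<dots> = (\<Sum>k<N. \<Sum>i\<in>I. if k = h i mod N then of_int (a i) * zeta N ^ k else 0)"
    by (rule sum.swap)
  also have "\<dots> = (\<Sum>k<N. of_int (\<Sum>i\<in>I. if k = h i mod N then a i else 0) * zeta N ^ k)"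
    unfolding of_int_sum sum_distrib_right by (intro sum.cong) auto
  finally show ?thesis by (rule ZringI)
qed

lemma Zring_zeta: "N > 0 \<Longrightarrow> zeta N ^ k \<in> Zring N"
  using Zring_sum[of N "{0::nat}" "\<lambda>_. 1" "\<lambda>_. k"] by simp

lemma Zring_int: "N > 0 \<Longrightarrow> of_int k \<in> Zring N"
  using Zring_sum[of N "{0::nat}" "\<lambda>_. k" "\<lambda>_. 0"] by simp

lemma Zring_add:
  assumes "x \<in> Zring N" "y \<in> Zring N" shows "x + y \<in> Zring N"
proof -
  obtain a b where "x = (\<Sum>k<N. of_int (a k) * zeta N ^ k)" "y = (\<Sum>k<N. of_int (b k) * zeta N ^ k)"
    using assms unfolding Zring_def by blast
  then have "x + y = (\<Sum>k<N. of_int (a k + b k) * zeta N ^ k)"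
    by (simp add: distrib_right sum.distrib)
  then show ?thesis by (rule ZringI)
qed

lemma Zring_mult:
  assumes "N > 0" "x \<in> Zring N" "y \<in> Zring N" shows "x * y \<in> Zring N"
proof -
  obtain a b where "x = (\<Sum>k<N. of_int (a k) * zeta N ^ k)" "y = (\<Sum>k<N. of_int (b k) * zeta N ^ k)"
    using assms unfolding Zring_def by blast
  then have "x * y = (\<Sum>(k,l)\<in>{..<N} \<times> {..<N}. of_int (a k * b l) * zeta N ^ (k + l))"
    by (simp add: sum_product sum.cartesian_product power_add mult_ac case_prod_unfold)
  also have "\<dots> \<in> Zring N"
    using Zring_sum[OF assms(1), of "{..<N} \<times> {..<N}" "\<lambda>i. a (fst i) * b (snd i)" "\<lambda>i. fst i + snd i"]
    by (simp add: case_prod_unfold)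
  finally show ?thesis .
qed

lemma Zring_uminus:
  assumes "N > 0" "x \<in> Zring N" shows "- x \<in> Zring N"
  using Zring_mult[OF assms(1) Zring_int[OF assms(1), of "-1"] assms(2)] by simp

text \<open>Coefficients need not be unique, so properties are propagated from roots of unity
  through sums and negatives instead of being read off a representation.\<close>

lemma Zring_induct [consumes 2, case_names zero zeta add uminus]:
  assumes "N > 0" "x \<in> Zring N"
    and "P 0" "\<And>k. P (zeta N ^ k)"
    and add: "\<And>x y. x \<in> Zring N \<Longrightarrow> y \<in> Zring N \<Longrightarrow> P x \<Longrightarrow> P y \<Longrightarrow> P (x + y)"
    and uminus: "\<And>x. x \<in> Zring N \<Longrightarrow> P x \<Longrightarrow> P (- x)"
  shows "P x"
proof -
  have nat: "P (of_nat j * zeta N ^ k) \<and> of_nat j * zeta N ^ k \<in> Zring N" for j k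
  proof (induction j)
    case 0
    then show ?case using assms(3) Zring_int[OF assms(1), of 0] by simp
  next
    case (Suc j)
    then show ?case using add assms(4) Zring_zeta[OF assms(1)] Zring_add by (simp add: distrib_right)
  qed
  have int: "P (of_int j * zeta N ^ k) \<and> of_int j * zeta N ^ k \<in> Zring N" for j k
  proof (cases "j \<ge> 0")
    case True
    then show ?thesis using nat[of "nat j" k] by simp
  next
    case False
    then have "of_int j * zeta N ^ k = - (of_nat (nat (- j)) * zeta N ^ k)" by simp
    then show ?thesis using uminus nat[of "nat (-j)" k] Zring_uminus[OF assms(1)] by metis
  qed
  obtain a where x: "x = (\<Sum>k<N. of_int (a k) * zeta N ^ k)"
    using assms unfolding Zring_def by blast
  have "P (\<Sum>k<n. of_int (a k) * zeta N ^ k) \<and> (\<Sum>k<n. of_int (a k) * zeta N ^ k) \<in> Zring N" for n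
  proof (induction n)
    case 0
    then show ?case using assms(3) Zring_int[OF assms(1), of 0] by simp
  next
    case (Suc n)
    then show ?case using add int Zring_add by simp
  qed
  then show ?thesis using x by blast
qed

text \<open>\<open>y\<close> is an eigenvalue of the integer matrix of multiplication by \<open>y\<close> on the powers of \<open>zeta N\<close>.\<close>

lemma Zring_algebraic_int:
  assumes "N > 0" "y \<in> Zring N"
  shows "algebraic_int y"
proof -
  have "\<forall>k. \<exists>b. y * zeta N ^ k = (\<Sum>l<N. of_int (b l) * zeta N ^ l)"
    using Zring_mult[OF assms Zring_zeta[OF assms(1)]] unfolding Zring_def by blast
  then obtain b where b: "\<And>k. y * zeta N ^ k = (\<Sum>l<N. of_int (b k l) * zeta N ^ l)" by metis
  define B :: "int mat" where "B = mat N N (\<lambda>(k,l). b k l)"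
  define v where "v = vec N (\<lambda>k. zeta N ^ k)"
  have B: "B \<in> carrier_mat N N" by (simp add: B_def)
  have "v $ 0 \<noteq> 0\<^sub>v N $ 0" using assms(1) by (simp add: v_def)
  then have "eigenvector (map_mat of_int B) v y"
    unfolding eigenvector_def using b
    by (auto simp: B_def v_def scalar_prod_def lessThan_atLeast0 intro!: eq_vecI)
  then have "poly (char_poly (map_mat of_int B)) y = 0"
    using eigenvalue_root_char_poly[of "map_mat of_int B" N y] B unfolding eigenvalue_def by auto
  then have "poly (map_poly of_int (char_poly B)) y = 0"
    by (simp add: of_int_hom.char_poly_hom[OF B])
  moreover have "lead_coeff (char_poly B) = 1" using degree_monic_char_poly[OF B] by simp
  ultimately show ?thesis unfolding algebraic_int_altdef_ipoly by blast
qed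

section \<open>The residue map and Teichmueller representatives\<close>

lemma subring_set_Zring: "N > 0 \<Longrightarrow> subring_set (Zring N)"
  using Zring_int[of N 1] by unfold_locales (auto intro: Zring_add Zring_mult Zring_uminus)

text \<open>Frobenius is additive up to multiples of p even where p is nonzero. The step expands
  twice, first separating the error \<open>p z\<close> from \<open>X + Y\<close>, then
  \<open>X\<close> from \<open>Y\<close>; p also divides the p-th power of
  \<open>p z\<close>.\<close>

lemma (in subring_set) power_prime_power_add:
  assumes "prime p" "x \<in> A" "y \<in> A"
  shows "\<exists>z\<in>A. (x + y) ^ (p ^ i) = x ^ (p ^ i) + y ^ (p ^ i) + of_nat p * z"
proof (induction i)
  case 0
  show ?case by (intro bexI[of _ 0]) auto
next
  case (Suc i)
  define g where "g a b = (\<Sum>k\<in>{1..<p}. of_nat ((p choose k) div p) * a ^ k * b ^ (p - k))" for a b :: 'b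
  have g: "g a b \<in> A" if "a \<in> A" "b \<in> A" for a b
    unfolding g_def using that by (intro sum_mem mult_mem power_mem) auto
  have g': "(a + b) ^ p = a ^ p + b ^ p + of_nat p * g a b" for a b
    unfolding g_def by (rule prime_binomial_expansion[OF assms(1)])
  obtain z where z: "z \<in> A" "(x + y) ^ (p ^ i) = x ^ (p ^ i) + y ^ (p ^ i) + of_nat p * z"
    using Suc by blast
  define X Y where "X = x ^ (p ^ i)" and "Y = y ^ (p ^ i)"
  have XY: "X \<in> A" "Y \<in> A" using assms by (auto simp: X_def Y_def intro: power_mem)
  have pw: "a ^ (p ^ Suc i) = (a ^ (p ^ i)) ^ p" for a :: 'b
    by (simp add: mult.commute flip: power_mult)
  have "(of_nat p * z) ^ p = of_nat p * (of_nat p ^ (p - 1) * z ^ p)"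
    using assms(1) prime_gt_0_nat[of p] by (cases p) (auto simp: power_mult_distrib mult_ac)
  then have "(x + y) ^ (p ^ Suc i) = X ^ p + Y ^ p +
      of_nat p * (g X Y + of_nat p ^ (p - 1) * z ^ p + g (X + Y) (of_nat p * z))"
    unfolding pw z(2) X_def[symmetric] Y_def[symmetric]
    unfolding g'[of "X + Y"] g'[of X] by (simp add: algebra_simps)
  moreover have "g X Y + of_nat p ^ (p - 1) * z ^ p + g (X + Y) (of_nat p * z) \<in> A"
    using XY z by (intro add_mem mult_mem power_mem g of_nat_mem)
  ultimately show ?case unfolding pw X_def Y_def by blast
qed

text \<open>Translation by 1 permutes the ring, so the sum of all elements is unchanged when 1 is
  added to each of them.\<close>

lemma of_nat_CARD_eq_0: "of_nat CARD('a) = (0::'a::{comm_ring_1,finite})"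
proof -
  have "(\<Sum>x\<in>UNIV. x + 1) = (\<Sum>x\<in>(UNIV::'a set). x)"
    by (rule sum.reindex_bij_witness[of _ "\<lambda>x. x - 1" "\<lambda>x. x + 1"]) auto
  then show ?thesis by (simp add: sum.distrib)
qed

locale teichmuller =
  fixes p d N :: nat and \<phi> :: "complex \<Rightarrow> 'a::{field,finite}"
  assumes prime: "prime p" and card: "CARD('a) = p ^ d" and N_def: "N = CARD('a) - 1"
    and residue: "residue_map N \<phi>"
begin

lemma p2: "p \<ge> 2" using prime by (rule prime_ge_2_nat)

lemma p0: "p > 0" using p2 by simp

lemma card_ge_2: "CARD('a) \<ge> 2"
proof -
  have "card {0, 1::'a} \<le> CARD('a)" by (rule card_mono) auto
  then show ?thesis by simp
qed

lemma N_pos [simp]: "N > 0" using card_ge_2 N_def by simp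

lemma N_nz [simp]: "N \<noteq> 0" and Suc_0_le_N [simp]: "Suc 0 \<le> N"
  using N_pos by linarith+

lemma card_N: "p ^ d = Suc N" using card card_ge_2 N_def by simp

lemma d_pos: "d > 0"
  using card_N N_pos by (cases d) auto

lemma of_nat_p [simp]: "of_nat p = (0::'a)"
  using of_nat_CARD_eq_0[where 'a='a] unfolding card by simp

lemma of_nat_N [simp]: "of_nat N = (-1::'a)"
proof -
  have "of_nat (Suc N) = (0::'a)" unfolding card_N[symmetric] using d_pos by simp
  then show ?thesis by (simp add: eq_neg_iff_add_eq_0 add.commute)
qed

lemma phi_add: "x \<in> Zring N \<Longrightarrow> y \<in> Zring N \<Longrightarrow> \<phi> (x + y) = \<phi> x + \<phi> y"
  and phi_mult: "x \<in> Zring N \<Longrightarrow> y \<in> Zring N \<Longrightarrow> \<phi> (x * y) = \<phi> x * \<phi> y"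
  and phi_one: "\<phi> 1 = 1"
  using residue unfolding residue_map_def by blast+

text \<open>Modulo p this power map is additive, and it fixes each power of \<open>zeta N\<close>
  because p^d = N + 1.\<close>

lemma Zring_power_card:
  assumes "x \<in> Zring N"
  shows "\<exists>z\<in>Zring N. x ^ (p ^ d) = x + of_nat p * z"
  using N_pos assms
proof (induction rule: Zring_induct)
  interpret subring_set "Zring N" by (rule subring_set_Zring) simp
  {
    case zero
    show ?case using p0 by (intro bexI[of _ 0]) auto
  next
    case (zeta k)
    have "(zeta N ^ k) ^ (p ^ d) = (zeta N ^ N) ^ k * zeta N ^ k"
      unfolding card_N by (simp add: power_add mult_ac flip: power_mult del: zeta_power_N)
    then show ?case by (intro bexI[of _ 0]) auto
  next
    case (add x y)
    obtain z where "z \<in> Zring N" "(x + y) ^ (p ^ d) = x ^ (p ^ d) + y ^ (p ^ d) + of_nat p * z"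
      using power_prime_power_add[OF prime add(1,2)] by blast
    moreover obtain z1 z2 where "z1 \<in> Zring N" "z2 \<in> Zring N"
      "x ^ (p ^ d) = x + of_nat p * z1" "y ^ (p ^ d) = y + of_nat p * z2" using add by blast
    ultimately show ?case
      by (intro bexI[of _ "z + z1 + z2"]) (auto simp: algebra_simps intro: add_mem)
  next
    case (uminus x)
    \<comment> \<open>Expanding the power of x + (- x) = 0 avoids evaluating the sign of (-1)^(p^d),
      which would single out p = 2.\<close>
    obtain z where "z \<in> Zring N" "(x + - x) ^ (p ^ d) = x ^ (p ^ d) + (- x) ^ (p ^ d) + of_nat p * z"
      using power_prime_power_add[OF prime uminus(1) uminus_mem[OF uminus(1)]] by blast
    moreover obtain z1 where "z1 \<in> Zring N" "x ^ (p ^ d) = x + of_nat p * z1" using uminus by blast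
    moreover have "(0::complex) ^ (p ^ d) = 0" using p0 by simp
    ultimately show ?case
      by (intro bexI[of _ "- z - z1"]) (auto simp: algebra_simps add_eq_0_iff intro: diff_mem uminus_mem)
  }
qed

lemma phi_zero: "\<phi> 0 = 0"
proof -
  interpret subring_set "Zring N" by (rule subring_set_Zring) simp
  show ?thesis using phi_add[of 0 0] by (metis add_cancel_right_right add_0 zero_mem)
qed

text \<open>\<open>p\<close> is unramified: \<open>x ^ p ^ d = x + p z\<close> reads \<open>(1 - x ^ N) x = - p z\<close>, and \<open>1 - x ^ N\<close> reduces to \<open>1\<close>
  whenever \<open>x\<close> reduces to \<open>0\<close>.\<close>

sublocale R: uniformized "Zring N" \<phi> "of_nat p"
proof -
  interpret subring_set "Zring N" by (rule subring_set_Zring) simp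
  have phi_nat: "\<phi> (of_nat n) = of_nat n" for n
    by (induction n) (auto simp: phi_add phi_zero phi_one)
  have phi_um: "\<phi> (- x) = - \<phi> x" if "x \<in> Zring N" for x
    using phi_add[OF that uminus_mem[OF that]] by (simp add: phi_zero eq_neg_iff_add_eq_0 add.commute)
  show "uniformized (Zring N) \<phi> (of_nat p)"
  proof unfold_locales
    fix x assume x: "x \<in> Zring N" "\<phi> x = 0"
    obtain z where z: "z \<in> Zring N" "x ^ (p ^ d) = x + of_nat p * z" using Zring_power_card[OF x(1)] by blast
    then have z': "x * x ^ N = x + of_nat p * z" unfolding card_N by simp
    have xN: "x ^ N \<in> Zring N" by (intro power_mem x)
    have "x ^ N = x * x ^ (N - 1)" using N_pos by (simp flip: power_Suc)
    then have "\<phi> (x ^ N) = 0" using phi_mult x power_mem by simp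
    then have "\<phi> (1 - x ^ N) = 1"
      using phi_add[of 1 "- (x ^ N)"] xN by (simp add: phi_um uminus_mem phi_one)
    moreover have "(1 - x ^ N) * x = of_nat p * (- z)" using z' by (simp add: algebra_simps)
    ultimately show "\<exists>s\<in>Zring N. \<phi> s \<noteq> 0 \<and> (\<exists>y\<in>Zring N. s * x = of_nat p * y)"
      using z xN by (intro bexI[of _ "1 - x ^ N"] conjI bexI[of _ "- z"]) (auto intro: diff_mem uminus_mem)
  qed (use phi_add phi_mult phi_one phi_nat p0 in auto)
qed

lemma nu_eq: "nu p N \<phi> x = (SUP t\<in>{t. R.vge t x}. ereal (real t))"
  unfolding nu_def R.vge_def by simp

lemma zeta_mem [simp]: "zeta N ^ k \<in> Zring N"
  by (simp add: Zring_zeta)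

lemma phi_zeta_nz: "\<phi> (zeta N ^ i) \<noteq> 0"
proof
  assume "\<phi> (zeta N ^ i) = 0"
  moreover have "(zeta N ^ i) ^ N = (zeta N ^ N) ^ i"
    by (simp add: mult.commute flip: power_mult del: zeta_power_N)
  then have "\<phi> (zeta N ^ i) ^ N = 1" by (simp flip: R.hom_power)
  ultimately show False using N_pos by (simp add: zero_power)
qed

text \<open>Distinct roots with equal reduction have a quotient \<open>w \<noteq> 1\<close> that
  reduces to 1. The geometric sum of \<open>w\<close> is then 0, but it reduces to N, which is -1 in
  the field.\<close>

lemma phi_zeta_eq_iff: "\<phi> (zeta N ^ i) = \<phi> (zeta N ^ j) \<longleftrightarrow> [i = j] (mod N)"
proof
  assume eq: "\<phi> (zeta N ^ i) = \<phi> (zeta N ^ j)"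
  have le: "[i = j] (mod N)" if le: "i \<le> j" and eq: "\<phi> (zeta N ^ i) = \<phi> (zeta N ^ j)" for i j
  proof (rule ccontr)
    define w where "w = zeta N ^ (j - i)"
    assume "\<not> [i = j] (mod N)"
    then have "\<not> N dvd (j - i)" using le by (metis cong_altdef_nat cong_sym)
    then have "w \<noteq> 1" by (simp add: w_def zeta_power_eq_1_iff)
    moreover have "w ^ N = 1" unfolding w_def by (metis power_mult mult.commute zeta_power_N power_one)
    ultimately have "(\<Sum>k<N. w ^ k) = 0" by (intro sum_root_of_unity)
    moreover have "\<phi> w = 1"
    proof -
      have "zeta N ^ i * w = zeta N ^ j" using le by (simp add: w_def flip: power_add)
      then have "\<phi> (zeta N ^ i) * \<phi> w = \<phi> (zeta N ^ i) * 1"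
        using eq R.hom_mult[of "zeta N ^ i" w] by (simp add: w_def)
      then show ?thesis by (simp add: phi_zeta_nz)
    qed
    ultimately have "0 = (\<Sum>k<N. (1::'a))"
      using R.hom_sum[of "{..<N}" "\<lambda>k. w ^ k"] by (simp add: R.hom_power w_def R.power_mem)
    then show False by simp
  qed
  show "[i = j] (mod N)" using le[of i j] le[of j i] eq by (metis cong_sym nat_le_linear)
qed (use zeta_power_cong in metis)

lemma bij_phi_zeta: "bij_betw (\<lambda>j. \<phi> (zeta N ^ j)) {..<N} (UNIV - {0})"
proof -
  have inj: "inj_on (\<lambda>j. \<phi> (zeta N ^ j)) {..<N}"
    by (auto simp: inj_on_def phi_zeta_eq_iff cong_def)
  moreover have "(\<lambda>j. \<phi> (zeta N ^ j)) ` {..<N} = UNIV - {0}"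
  proof (rule card_subset_eq)
    show "card ((\<lambda>j. \<phi> (zeta N ^ j)) ` {..<N}) = card (UNIV - {0::'a})"
      using inj by (simp add: card_image N_def)
  qed (auto simp: phi_zeta_nz)
  ultimately show ?thesis unfolding bij_betw_def ..
qed

lemma nonzero_obtain:
  assumes "x \<noteq> 0" obtains j where "j < N" "x = \<phi> (zeta N ^ j)"
  using bij_phi_zeta assms unfolding bij_betw_def by auto

definition T where "T = teich N \<phi>"

lemma T_zero [simp]: "T 0 = 0" by (simp add: T_def teich_def)

lemma T_phi_zeta [simp]: "T (\<phi> (zeta N ^ j)) = zeta N ^ j"
proof -
  have "(THE z. (\<exists>i<N. z = zeta N ^ i) \<and> \<phi> z = \<phi> (zeta N ^ j)) = zeta N ^ j"
  proof (rule the_equality)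
    have "zeta N ^ j = zeta N ^ (j mod N)" by (simp add: zeta_power_mod)
    then show "(\<exists>i<N. zeta N ^ j = zeta N ^ i) \<and> \<phi> (zeta N ^ j) = \<phi> (zeta N ^ j)"
      using N_pos by (meson mod_less_divisor)
  qed (auto simp: phi_zeta_eq_iff intro: zeta_power_cong)
  then show ?thesis by (simp add: T_def teich_def phi_zeta_nz)
qed

lemma T_mem [simp]: "T x \<in> Zring N"
  by (cases "x = 0") (auto elim: nonzero_obtain)

lemma phi_T [simp]: "\<phi> (T x) = x"
  by (cases "x = 0") (auto elim!: nonzero_obtain)

lemma T_eq_iff [simp]: "T x = T y \<longleftrightarrow> x = y"
  by (metis phi_T)

lemma T_eq_0_iff [simp]: "T x = 0 \<longleftrightarrow> x = 0"
  using T_eq_iff[of x 0] by simp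

lemma T_mult: "T (x * y) = T x * T y"
proof (cases "x = 0 \<or> y = 0")
  case False
  then obtain i j where "x = \<phi> (zeta N ^ i)" "y = \<phi> (zeta N ^ j)" by (meson nonzero_obtain)
  then show ?thesis using T_phi_zeta[of "i + j"] by (simp add: R.hom_mult power_add)
qed auto

lemma T_one [simp]: "T 1 = 1"
  using T_phi_zeta[of 0] by simp

lemma T_power: "T (x ^ n) = T x ^ n"
  by (induction n) (auto simp: T_mult)

lemma T_inverse: "T (inverse x) = inverse (T x)"
proof (cases "x = 0")
  case False
  then have "T x * T (inverse x) = 1" by (simp flip: T_mult)
  then show ?thesis by (simp add: inverse_unique)
qed simp

lemma power_N:
  assumes "x \<noteq> 0" shows "x ^ N = (1::'a)"
proof -
  from assms obtain j where "x = \<phi> (zeta N ^ j)" by (rule nonzero_obtain)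
  then have "x ^ N = \<phi> ((zeta N ^ N) ^ j)"
    by (simp add: mult.commute flip: R.hom_power power_mult del: zeta_power_N)
  then show "x ^ N = 1" by simp
qed

lemma power_card [simp]: "x ^ (p ^ d) = (x::'a)"
  using power_N[of x] unfolding card_N by (cases "x = 0") auto

lemma T_power_N: "x \<noteq> 0 \<Longrightarrow> T x ^ N = 1"
  by (simp add: power_N flip: T_power)

end

section \<open>Adjoining a primitive p-th root of unity\<close>

lemma Zring_mono:
  assumes "N > 0" "p > 0" "x \<in> Zring N" shows "x \<in> Zring (N * p)"
  using assms(1,3)
proof (induction rule: Zring_induct)
  case (zeta k)
  have "zeta N ^ k = zeta (N * p) ^ (p * k)"
    using zeta_mult_power(1)[OF assms(1,2)] by (simp add: power_mult)
  then show ?case using Zring_zeta[of "N * p"] assms by simp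
qed (use assms Zring_int[of "N * p" 0] in \<open>auto intro: Zring_add Zring_uminus\<close>)

context teichmuller
begin

abbreviation W where "W \<equiv> Zring (N * p)"

definition \<pi> :: complex where "\<pi> = 1 - zeta p"

sublocale W_set: subring_set W
  by (rule subring_set_Zring) (simp add: p0)

lemma Zring_W: "x \<in> Zring N \<Longrightarrow> x \<in> W"
  using p0 by (simp add: Zring_mono)

lemma zeta_p_W: "zeta p ^ k \<in> W"
proof -
  have "zeta p ^ k = zeta (N * p) ^ (N * k)"
    using zeta_mult_power(2)[of N p] p0 by (simp add: power_mult)
  then show ?thesis by (simp add: Zring_zeta p0)
qed

lemma pi_W: "\<pi> \<in> W"
  using zeta_p_W[of 1] by (simp add: \<pi>_def W_set.diff_mem)

lemma pi_nz: "\<pi> \<noteq> 0"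
proof
  assume "\<pi> = 0"
  then have "p dvd 1" using zeta_power_eq_1_iff[of p 1] p0 by (simp add: \<pi>_def)
  then show False using p2 by simp
qed

text \<open>The cofactor of \<open>- p\<close> in \<open>(- \<pi>) ^ (p - 1)\<close>, obtained by expanding \<open>(1 - \<pi>) ^ p = 1\<close>.\<close>

definition Y :: complex where
  "Y = (\<Sum>k\<in>{1..<p}. of_nat ((p choose k) div p) * (- \<pi>) ^ (k - 1))"

lemma Y_W: "Y \<in> W"
  unfolding Y_def by (intro W_set.sum_mem W_set.mult_mem W_set.power_mem W_set.uminus_mem pi_W W_set.of_nat_mem)

text \<open>The term k = 1 is p / p = 1 and all others contain \<pi>. So \<open>Y\<close> is a local
  unit, and \<open>pi_power\<close> exhibits p - 1 as the ramification index of p.\<close>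

lemma Y_eq: "\<exists>v\<in>W. Y = 1 + \<pi> * v"
proof -
  define c where "c k = (of_nat ((p choose k) div p) :: complex)" for k
  have "{1..<p} = insert 1 {2..<p}" using p2 by auto
  then have "Y = 1 + (\<Sum>k\<in>{2..<p}. c k * (- \<pi>) ^ (k - 1))"
    using p0 by (simp add: Y_def c_def)
  also have "(\<Sum>k\<in>{2..<p}. c k * (- \<pi>) ^ (k - 1)) = \<pi> * (\<Sum>k\<in>{2..<p}. - c k * (- \<pi>) ^ (k - 2))"
    unfolding sum_distrib_left
  proof (rule sum.cong)
    fix k assume "k \<in> {2..<p}"
    then have "k - 1 = Suc (k - 2)" by (metis Suc_1 Suc_diff_Suc Suc_le_lessD atLeastLessThan_iff diff_Suc_1)
    then show "c k * (- \<pi>) ^ (k - 1) = \<pi> * (- c k * (- \<pi>) ^ (k - 2))" by simp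
  qed simp
  finally show ?thesis
    by (intro bexI[of _ "\<Sum>k\<in>{2..<p}. - c k * (- \<pi>) ^ (k - 2)"] W_set.sum_mem W_set.mult_mem
        W_set.power_mem W_set.uminus_mem pi_W) (simp_all add: c_def)
qed

lemma pi_power: "(- \<pi>) ^ (p - 1) = - of_nat p * Y"
proof -
  have "(- \<pi> + 1) ^ p = (- \<pi>) ^ p + 1 ^ p + of_nat p *
      (\<Sum>k\<in>{1..<p}. of_nat ((p choose k) div p) * (- \<pi>) ^ k * 1 ^ (p - k))"
    by (rule prime_binomial_expansion[OF prime])
  also have "(\<Sum>k\<in>{1..<p}. of_nat ((p choose k) div p) * (- \<pi>) ^ k * 1 ^ (p - k)) = - \<pi> * Y"
    unfolding Y_def sum_distrib_left
  proof (rule sum.cong)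
    fix k assume "k \<in> {1..<p}"
    then have "(- \<pi>) ^ k = - \<pi> * (- \<pi>) ^ (k - 1)" by (cases k) auto
    then show "of_nat ((p choose k) div p) * (- \<pi>) ^ k * 1 ^ (p - k) =
      - \<pi> * (of_nat ((p choose k) div p) * (- \<pi>) ^ (k - 1))" by simp
  qed simp
  also have "(- \<pi>) ^ p = - \<pi> * (- \<pi>) ^ (p - 1)" using p0 by (cases p) auto
  also have "(- \<pi> + 1) ^ p = 1" by (simp add: \<pi>_def)
  finally have "- \<pi> * ((- \<pi>) ^ (p - 1) + of_nat p * Y) = 0" unfolding distrib_left by (simp add: mult_ac)
  then have "(- \<pi>) ^ (p - 1) + of_nat p * Y = 0" using pi_nz by simp
  then show ?thesis by (simp add: add_eq_0_iff2)
qed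

lemma pi_power': "\<pi> ^ (p - 1) = of_nat p * ((-1) ^ p * Y)"
proof -
  have "\<pi> ^ (p - 1) = (-1) ^ (p - 1) * (- \<pi>) ^ (p - 1)" by (simp flip: power_mult_distrib)
  also have "\<dots> = of_nat p * (- ((-1) ^ (p - 1)) * Y)" unfolding pi_power by simp
  also have "- ((-1) ^ (p - 1)) = ((-1) ^ p :: complex)" using p0 by (cases p) auto
  finally show ?thesis .
qed

text \<open>Clearing denominators in an integral equation of \<open>y\<close> shows that a power of \<open>x\<close> lies in \<open>p Z[zeta]\<close>.\<close>

lemma phi_eq_0_of_p_mult:
  assumes "x \<in> Zring N" "y \<in> W" "x = of_nat p * y"
  shows "\<phi> x = 0"
proof -
  have "algebraic_int y" using assms(2) Zring_algebraic_int[of "N * p"] p0 by simp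
  then obtain g where g: "poly (map_poly of_int g) y = 0" "lead_coeff g = 1"
    unfolding algebraic_int_altdef_ipoly by blast
  define n where "n = degree g"
  define h where "h i = (of_int (coeff g i) :: complex)" for i
  have deg: "degree (map_poly of_int g :: complex poly) = n" by (simp add: n_def)
  have "(\<Sum>i\<le>n. h i * y ^ i) = 0"
    using g(1) unfolding poly_altdef deg by (simp add: h_def)
  then have "of_nat p ^ n * (\<Sum>i\<le>n. h i * y ^ i) = 0" by simp
  moreover have "of_nat p ^ n * (\<Sum>i\<le>n. h i * y ^ i) = (\<Sum>i\<le>n. h i * of_nat p ^ (n - i) * x ^ i)"
    unfolding sum_distrib_left
  proof (rule sum.cong)
    fix i assume "i \<in> {..n}"
    then have "of_nat p ^ n = of_nat p ^ (n - i) * (of_nat p :: complex) ^ i" by (simp flip: power_add)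
    then show "of_nat p ^ n * (h i * y ^ i) = h i * of_nat p ^ (n - i) * x ^ i"
      unfolding assms(3) by (simp add: power_mult_distrib mult_ac)
  qed simp
  ultimately have "(\<Sum>i\<le>n. h i * of_nat p ^ (n - i) * x ^ i) = 0" by simp
  moreover have "{..n} = insert n {..<n}" by auto
  ultimately have *: "x ^ n + (\<Sum>i<n. h i * of_nat p ^ (n - i) * x ^ i) = 0"
    using g(2) by (simp add: h_def n_def)
  have hR: "h i \<in> Zring N" for i unfolding h_def by (simp add: Zring_int)
  have tR: "h i * of_nat p ^ (n - i) * x ^ i \<in> Zring N" for i
    using hR assms(1) by (intro R.mult_mem R.power_mem) auto
  have t0: "\<phi> (h i * of_nat p ^ (n - i) * x ^ i) = 0" if "i < n" for i
    using hR assms(1) that by (simp add: R.hom_mult R.hom_power R.power_mem R.mult_mem zero_power)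
  have "\<phi> (x ^ n) + 0 = 0"
    using arg_cong[OF *, of \<phi>] tR t0 assms(1)
    by (simp add: R.hom_add R.hom_sum R.power_mem R.sum_mem)
  moreover have "\<phi> (x ^ n) = \<phi> x ^ n" using assms(1) by (rule R.hom_power)
  ultimately show ?thesis by simp
qed

text \<open>Passing to (p - 1)-st powers turns the factor \<pi> into a factor p.\<close>

lemma phi_eq_0_of_pi_mult:
  assumes "x \<in> Zring N" "w \<in> W" "x = \<pi> * w"
  shows "\<phi> x = 0"
proof -
  have "x ^ (p - 1) = of_nat p * ((-1) ^ p * Y * w ^ (p - 1))"
    unfolding assms(3) power_mult_distrib pi_power' by (simp add: mult_ac)
  moreover have "(-1) ^ p * Y * w ^ (p - 1) \<in> W"
    by (intro W_set.mult_mem W_set.power_mem Y_W assms W_set.uminus_mem W_set.one_mem)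
  ultimately have "\<phi> (x ^ (p - 1)) = 0"
    using phi_eq_0_of_p_mult assms(1) R.power_mem by blast
  then show ?thesis using assms(1) by (simp add: R.hom_power)
qed

lemma zeta_p_power: "zeta p ^ j = 1 + \<pi> * (- (\<Sum>i<j. zeta p ^ i))"
  using one_diff_power_eq[of "zeta p" j] by (simp add: \<pi>_def algebra_simps)

text \<open>Adjoining \<open>zeta p\<close> does not enlarge the residue field:
  \<open>zeta p\<close> is 1 modulo \<pi>, so each power of \<open>zeta (N * p)\<close> is congruent
  to a power of \<open>zeta N\<close>.\<close>

lemma W_rep: "x \<in> W \<Longrightarrow> \<exists>r\<in>Zring N. \<exists>w\<in>W. x = r + \<pi> * w"
proof -
  assume x: "x \<in> W"
  have "N * p > 0" using p0 by simp
  then show "\<exists>r\<in>Zring N. \<exists>w\<in>W. x = r + \<pi> * w" using x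
  proof (induction rule: Zring_induct)
    case zero
    show ?case by (intro bexI[of _ 0]) auto
  next
    case (zeta k)
    have e1: "zeta (N * p) ^ (p * p ^ (d - 1)) = zeta N ^ (p ^ (d - 1))"
      using zeta_mult_power(1)[of N p] p0 by (simp add: power_mult)
    have e2: "zeta (N * p) ^ (N * (p - 1)) = zeta p ^ (p - 1)"
      using zeta_mult_power(2)[of N p] p0 by (simp add: power_mult)
    \<comment> \<open>A Bezout identity for p and N, explicit because N + 1 = p^d. It splits
      \<open>zeta (N * p)\<close> into a power of \<open>zeta N\<close> and a power of
      \<open>zeta p\<close>.\<close>
    have "p * p ^ (d - 1) + N * (p - 1) = Suc (N * p)"
    proof -
      have "p * p ^ (d - 1) = Suc N" using card_N d_pos by (cases d) auto
      moreover have "N * p = N * (p - 1) + N" using p0 by (cases p) auto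
      ultimately show ?thesis by simp
    qed
    then have "zeta (N * p) = zeta N ^ (p ^ (d - 1)) * zeta p ^ (p - 1)"
      unfolding e1[symmetric] e2[symmetric] by (simp flip: power_add)
    then have zk: "zeta (N * p) ^ k = zeta N ^ (p ^ (d - 1) * k) * zeta p ^ ((p - 1) * k)"
      by (simp add: power_mult_distrib power_mult)
    have "zeta (N * p) ^ k = zeta N ^ (p ^ (d - 1) * k) +
        \<pi> * (zeta N ^ (p ^ (d - 1) * k) * - (\<Sum>i<(p - 1) * k. zeta p ^ i))"
      unfolding zk zeta_p_power[of "(p - 1) * k"] by (simp only: distrib_left mult_1_right mult.left_commute)
    moreover have "zeta N ^ (p ^ (d - 1) * k) * - (\<Sum>i<(p - 1) * k. zeta p ^ i) \<in> W"
      by (intro W_set.mult_mem W_set.uminus_mem W_set.sum_mem zeta_p_W Zring_W zeta_mem)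
    ultimately show ?case using zeta_mem by blast
  next
    case (add x y)
    then obtain r w r' w' where *: "r \<in> Zring N" "w \<in> W" "r' \<in> Zring N" "w' \<in> W"
      "x = r + \<pi> * w" "y = r' + \<pi> * w'" by blast
    then show ?case
      by (intro bexI[of _ "r + r'"] bexI[of _ "w + w'"])
        (auto simp: algebra_simps intro: R.add_mem W_set.add_mem)
  next
    case (uminus x)
    then obtain r w where *: "r \<in> Zring N" "w \<in> W" "x = r + \<pi> * w" by blast
    then show ?case
      by (intro bexI[of _ "- r"] bexI[of _ "- w"]) (auto intro: R.uminus_mem W_set.uminus_mem)
  qed
qed

text \<open>The extension of \<open>\<phi>\<close> to \<open>W\<close> that sends \<open>zeta p\<close> to \<open>1\<close>. It does not depend on the chosen \<open>r\<close>, since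
  multiples of \<open>\<pi>\<close> in \<open>Zring N\<close> reduce to \<open>0\<close>.\<close>

definition \<phi>' :: "complex \<Rightarrow> 'a" where
  "\<phi>' x = \<phi> (SOME r. r \<in> Zring N \<and> (\<exists>w\<in>W. x = r + \<pi> * w))"

lemma phi'_eq:
  assumes "r \<in> Zring N" "w \<in> W"
  shows "\<phi>' (r + \<pi> * w) = \<phi> r"
proof -
  define s where "s = (SOME s. s \<in> Zring N \<and> (\<exists>v\<in>W. r + \<pi> * w = s + \<pi> * v))"
  have "s \<in> Zring N \<and> (\<exists>v\<in>W. r + \<pi> * w = s + \<pi> * v)"
    unfolding s_def by (rule someI[of _ r]) (use assms in blast)
  then obtain v where s: "s \<in> Zring N" "v \<in> W" "r + \<pi> * w = s + \<pi> * v" by blast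
  have "s - r = \<pi> * (w - v)" using s(3) by (simp add: algebra_simps)
  then have "\<phi> (s - r) = 0"
    by (intro phi_eq_0_of_pi_mult[of _ "w - v"] R.diff_mem W_set.diff_mem assms s)
  moreover have "\<phi>' (r + \<pi> * w) = \<phi> s" unfolding \<phi>'_def s_def ..
  ultimately show ?thesis using assms s by (simp add: R.hom_diff)
qed

lemma phi'_eq_phi: "r \<in> Zring N \<Longrightarrow> \<phi>' r = \<phi> r"
  using phi'_eq[of r 0] by simp

text \<open>For \<open>divide_u\<close>, the \<open>Zring N\<close> part of an element of the kernel
  becomes divisible by p after multiplication by some local unit s; multiplying by \<open>Y\<close>
  as well turns this p into a multiple of \<pi>.\<close>

sublocale W: uniformized W \<phi>' \<pi>
proof unfold_locales
  fix x y assume "x \<in> W" "y \<in> W"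
  then obtain r w r' w' where *: "r \<in> Zring N" "w \<in> W" "r' \<in> Zring N" "w' \<in> W"
      "x = r + \<pi> * w" "y = r' + \<pi> * w'" by (meson W_rep)
  have "x + y = (r + r') + \<pi> * (w + w')" by (simp add: * distrib_left)
  then show "\<phi>' (x + y) = \<phi>' x + \<phi>' y"
    using * by (simp only: phi'_eq R.add_mem W_set.add_mem R.hom_add)
  have "x * y = r * r' + \<pi> * (r * w' + r' * w + \<pi> * w * w')" by (simp add: * algebra_simps)
  moreover have "r * w' + r' * w + \<pi> * w * w' \<in> W"
    by (intro W_set.add_mem W_set.mult_mem pi_W * Zring_W[OF *(1)] Zring_W[OF *(3)])
  ultimately show "\<phi>' (x * y) = \<phi>' x * \<phi>' y"
    using * by (simp add: phi'_eq R.mult_mem R.hom_mult)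
next
  show "\<phi>' 1 = 1" by (simp add: phi'_eq_phi)
  show "\<phi>' \<pi> = 0" using phi'_eq[of 0 1] by simp
  fix x assume "x \<in> W" "\<phi>' x = 0"
  then obtain r w where *: "r \<in> Zring N" "w \<in> W" "x = r + \<pi> * w" by (meson W_rep)
  then have "\<phi> r = 0" using \<open>\<phi>' x = 0\<close> phi'_eq by simp
  then obtain s y where s: "s \<in> Zring N" "\<phi> s \<noteq> 0" "y \<in> Zring N" "s * r = of_nat p * y"
    using R.divide_u[OF *(1)] by metis
  obtain v where v: "v \<in> W" "Y = 1 + \<pi> * v" using Y_eq by blast
  have "p - 1 = Suc (p - 2)" using p2 by simp
  then have pY: "of_nat p * Y = \<pi> * (- \<pi>) ^ (p - 2)" using pi_power by simp
  have "Y * s = s + \<pi> * (v * s)" by (simp add: v algebra_simps)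
  then have "\<phi>' (Y * s) \<noteq> 0" using s v by (simp only: phi'_eq W_set.mult_mem Zring_W) simp
  moreover have "Y * s * x = of_nat p * Y * y + \<pi> * (Y * s * w)"
    unfolding * using s(4) by (simp add: algebra_simps)
  then have "Y * s * x = \<pi> * ((- \<pi>) ^ (p - 2) * y + Y * s * w)"
    unfolding pY by (simp add: algebra_simps)
  moreover have "(- \<pi>) ^ (p - 2) * y + Y * s * w \<in> W"
    by (intro W_set.add_mem W_set.mult_mem W_set.power_mem W_set.uminus_mem pi_W Y_W *
        Zring_W[OF s(1)] Zring_W[OF s(3)])
  moreover have "Y * s \<in> W" using s by (intro W_set.mult_mem Y_W Zring_W)
  ultimately show "\<exists>s\<in>W. \<phi>' s \<noteq> 0 \<and> (\<exists>y\<in>W. s * x = \<pi> * y)" by blast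
qed (use pi_W pi_nz in auto)

lemma phi'_Y [simp]: "\<phi>' Y = 1"
  using Y_eq phi'_eq[of 1] by auto

lemma W_veq_p: "W.veq (p - 1) (of_nat p)"
proof -
  have "Y * of_nat p = \<pi> ^ (p - 1) * (- ((-1) ^ (p - 1)))"
  proof -
    have "(- \<pi>) ^ (p - 1) = \<pi> ^ (p - 1) * (-1) ^ (p - 1)" by (simp flip: power_mult_distrib)
    then show ?thesis using pi_power by (simp add: equation_minus_iff mult.commute)
  qed
  moreover have "- ((-1) ^ (p - 1)) \<in> W" by (intro W_set.uminus_mem W_set.power_mem W_set.one_mem)
  moreover have "\<phi>' (- ((-1) ^ (p - 1))) \<noteq> 0"
    by (simp add: W.hom_uminus W.hom_power W_set.power_mem W_set.uminus_mem)
  ultimately show ?thesis unfolding W.veq_def using Y_W phi'_Y by (metis one_neq_zero)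
qed

lemma W_veq_Zring:
  assumes "R.veq t x" shows "W.veq ((p - 1) * t) x"
proof -
  obtain s y where s: "s \<in> Zring N" "\<phi> s \<noteq> 0" "y \<in> Zring N" "\<phi> y \<noteq> 0" "s * x = of_nat p ^ t * y"
    using assms unfolding R.veq_def by blast
  have "W.veq ((p - 1) * t + 0) (of_nat p ^ t * y)"
    using s by (intro W.veq_mult W.veq_power W_veq_p W.veq_0I) (auto simp: phi'_eq_phi Zring_W)
  then have "W.veq ((p - 1) * t) (s * x)" using s by simp
  then show ?thesis by (rule W.veq_cancel_unit) (use s in \<open>auto simp: phi'_eq_phi Zring_W\<close>)
qed

lemma W_vge_Zring:
  assumes "R.vge t x" shows "W.vge ((p - 1) * t) x"
proof -
  obtain s y where s: "s \<in> Zring N" "\<phi> s \<noteq> 0" "y \<in> Zring N" "s * x = of_nat p ^ t * y"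
    using assms unfolding R.vge_def by blast
  obtain s' z where z: "s' \<in> W" "\<phi>' s' \<noteq> 0" "z \<in> W" "s' * of_nat p ^ t = \<pi> ^ ((p - 1) * t) * z"
    using W.veq_power[OF W_veq_p, of t] unfolding W.veq_def by blast
  have "(s' * s) * x = (s' * of_nat p ^ t) * y" using s by (simp add: mult_ac)
  also have "\<dots> = \<pi> ^ ((p - 1) * t) * (z * y)" using z by simp
  finally show ?thesis unfolding W.vge_def using s z
    by (intro bexI[of _ "s' * s"] conjI bexI[of _ "z * y"])
      (auto intro: W_set.mult_mem Zring_W simp: W.hom_mult phi'_eq_phi Zring_W)
qed

lemma of_nat_eq_0_iff: "of_nat n = (0::'a) \<longleftrightarrow> p dvd n"
proof
  assume n: "of_nat n = (0::'a)"
  show "p dvd n"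
  proof (rule ccontr)
    assume "\<not> p dvd n"
    then have "coprime p n" using prime by (simp add: prime_imp_coprime)
    then obtain a b where "p * a = n * b + 1" using bezout_nat[of p n] p0 by auto
    then have "of_nat (p * a) = (of_nat (n * b + 1) :: 'a)" by (rule arg_cong)
    then show False using n by simp
  qed
qed auto

text \<open>Translates divisibility of weights into valuations. The part of n prime to p is a local
  unit, being nonzero in characteristic p.\<close>

lemma W_vge_of_nat_iff: "W.vge ((p - 1) * t) (of_nat n) \<longleftrightarrow> p ^ t dvd n"
proof (cases "n = 0")
  case False
  define a where "a = multiplicity p n"
  obtain m where m: "n = p ^ a * m" "\<not> p dvd m"
    using multiplicity_decompose'[of n p] False not_prime_unit[of p] prime unfolding a_def by metis
  have "W.veq ((p - 1) * a + 0) (of_nat p ^ a * of_nat m)"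
    using m by (intro W.veq_mult W.veq_power W_veq_p W.veq_0I) (auto simp: of_nat_eq_0_iff)
  then have "W.veq ((p - 1) * a) (of_nat n)" using m by simp
  then have "W.vge ((p - 1) * t) (of_nat n) \<longleftrightarrow> (p - 1) * t \<le> (p - 1) * a" by (rule W.veq_vge_iff)
  also have "\<dots> \<longleftrightarrow> t \<le> a" using p2 by auto
  also have "\<dots> \<longleftrightarrow> p ^ t dvd n"
    unfolding a_def using False prime by (subst power_dvd_iff_le_multiplicity) auto
  finally show ?thesis .
qed simp

end

section \<open>Traces and the additive character\<close>

lemma minus_one_dvd_power_minus_one: "(q::nat) - 1 dvd q ^ m - 1"
proof (cases "q = 0")
  case False
  then have "[q = 1] (mod (q - 1))" by (simp add: cong_altdef_nat)
  then have "[q ^ m = 1] (mod (q - 1))" using cong_pow[of q 1 "q - 1" m] by simp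
  then show ?thesis using False by (simp add: cong_altdef_nat)
qed (cases m; simp)

lemma sum_lessThan_add: "(\<Sum>i<a + b. f i) = (\<Sum>i<a. f i) + (\<Sum>i<b. f (a + i))"
  for f :: "nat \<Rightarrow> 'a::comm_monoid_add"
  by (induction b) (simp_all add: add.assoc)

context teichmuller
begin

text \<open>Subfields are represented as fixed points of a power map, which covers q = p, p^e and
  p^d alike. An exponent j gives a fixed point iff N divides j (q - 1), that is, iff N / (q - 1)
  divides j.\<close>

lemma bij_subfield:
  assumes "q \<ge> 2" "q - 1 dvd N"
  shows "bij_betw (\<lambda>i. \<phi> (zeta N ^ (N div (q - 1) * i))) {..<q - 1} {x::'a. x ^ q = x \<and> x \<noteq> 0}"
proof -
  define c where "c = N div (q - 1)"
  have N: "N = c * (q - 1)" using assms by (simp add: c_def)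
  then have c: "c > 0" using N_pos by (metis gr0I mult_0 less_irrefl)
  have inj: "inj_on (\<lambda>i. \<phi> (zeta N ^ (c * i))) {..<q - 1}"
  proof (rule inj_onI)
    fix i j assume "i \<in> {..<q - 1}" "j \<in> {..<q - 1}" "\<phi> (zeta N ^ (c * i)) = \<phi> (zeta N ^ (c * j))"
    then have "c * i mod (c * (q - 1)) = c * j mod (c * (q - 1))"
      unfolding phi_zeta_eq_iff cong_def N[symmetric] by simp
    then show "i = j" using \<open>i \<in> _\<close> \<open>j \<in> _\<close> c by simp
  qed
  have iff: "\<phi> (zeta N ^ j) ^ q = \<phi> (zeta N ^ j) \<longleftrightarrow> c dvd j" for j
  proof -
    have "\<phi> (zeta N ^ j) ^ q = \<phi> (zeta N ^ (j * q))"
      by (simp add: power_mult flip: R.hom_power)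
    then have "\<phi> (zeta N ^ j) ^ q = \<phi> (zeta N ^ j) \<longleftrightarrow> [j * q = j] (mod N)"
      by (simp add: phi_zeta_eq_iff)
    also have "\<dots> \<longleftrightarrow> N dvd j * q - j" using assms(1) by (simp add: cong_altdef_nat)
    also have "j * q - j = j * (q - 1)" by (simp add: diff_mult_distrib2)
    also have "N dvd j * (q - 1) \<longleftrightarrow> c dvd j" unfolding N using assms(1) by simp
    finally show ?thesis .
  qed
  have "(\<lambda>i. \<phi> (zeta N ^ (c * i))) ` {..<q - 1} = {x::'a. x ^ q = x \<and> x \<noteq> 0}"
  proof (intro equalityI subsetI)
    fix x :: 'a assume "x \<in> {x. x ^ q = x \<and> x \<noteq> 0}"
    then obtain j where j: "j < N" "x = \<phi> (zeta N ^ j)" "x ^ q = x" using nonzero_obtain by blast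
    then obtain i where "j = c * i" using iff by auto
    then show "x \<in> (\<lambda>i. \<phi> (zeta N ^ (c * i))) ` {..<q - 1}" using j c unfolding N by auto
  qed (auto simp: iff phi_zeta_nz)
  then show ?thesis using inj unfolding bij_betw_def c_def by simp
qed

lemma subfield_split: "q > 0 \<Longrightarrow> {x::'a. x ^ q = x} = insert 0 {x. x ^ q = x \<and> x \<noteq> 0}"
  by (auto simp: zero_power)

lemma card_subfield:
  assumes "q \<ge> 2" "q - 1 dvd N"
  shows "card {x::'a. x ^ q = x} = q"
proof -
  have "card {x::'a. x ^ q = x \<and> x \<noteq> 0} = q - 1"
    using bij_betw_same_card[OF bij_subfield[OF assms]] by simp
  then show ?thesis using assms(1) by (subst subfield_split) auto
qed

text \<open>The value at s = 0 is q and not q - 1 because x = 0 contributes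
  \<open>T 0 ^ 0 = 1\<close>. For s > 0 the sum is geometric over the (q - 1)-st roots of
  unity.\<close>

lemma sum_T_subfield:
  assumes "q \<ge> 2" "q - 1 dvd N"
  shows "(\<Sum>x | x ^ q = x. T x ^ s) = (if s = 0 then of_nat q else if q - 1 dvd s then of_nat (q - 1) else 0)"
proof (cases "s = 0")
  case True
  then show ?thesis using card_subfield[OF assms] by simp
next
  case False
  define c where "c = N div (q - 1)"
  have N: "N = c * (q - 1)" using assms by (simp add: c_def)
  then have c: "c > 0" using N_pos by (metis gr0I mult_0 less_irrefl)
  define w where "w = zeta N ^ (c * s)"
  have "(\<Sum>x | x ^ q = x. T x ^ s) = (\<Sum>x | x ^ q = x \<and> x \<noteq> 0. T x ^ s)"
    using assms(1) False by (subst subfield_split) (auto simp: zero_power)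
  also have "\<dots> = (\<Sum>i<q - 1. T (\<phi> (zeta N ^ (c * i))) ^ s)"
    using sum.reindex_bij_betw[OF bij_subfield[OF assms], of "\<lambda>x. T x ^ s"] by (simp add: c_def)
  also have "\<dots> = (\<Sum>i<q - 1. w ^ i)"
    by (simp add: w_def mult_ac flip: power_mult)
  also have "\<dots> = (if q - 1 dvd s then of_nat (q - 1) else 0)"
  proof -
    have w1: "w = 1 \<longleftrightarrow> q - 1 dvd s"
      unfolding w_def zeta_power_eq_1_iff[OF N_pos] using c by (simp add: N)
    have "w ^ (q - 1) = (zeta N ^ N) ^ s"
      unfolding w_def power_mult[symmetric] by (simp add: N mult_ac)
    then have "w ^ (q - 1) = 1" by simp
    then show ?thesis using w1 sum_root_of_unity[of w "q - 1"] by auto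
  qed
  finally show ?thesis using False by simp
qed

lemma sum_T: "(\<Sum>x\<in>UNIV. T x ^ s) = (if s = 0 then of_nat (p ^ d) else if N dvd s then of_nat N else 0)"
proof -
  have "{x::'a. x ^ (p ^ d) = x} = UNIV" by simp
  then show ?thesis using sum_T_subfield[of "p ^ d" s] N_pos by (simp add: card_N)
qed

lemma inverse_bij: "bij (inverse :: 'a \<Rightarrow> 'a)"
  by (rule bij_betw_byWitness[of _ inverse]) auto

lemma sum_T_inverse: "(\<Sum>x\<in>UNIV. T (inverse x) ^ s) = (\<Sum>x\<in>UNIV. T x ^ s)"
  using sum.reindex_bij_betw[OF inverse_bij, of "\<lambda>x. T x ^ s"] by simp

lemma trace_add:
  "q = p ^ e \<Longrightarrow> trace q m (x + y :: 'a) = trace q m x + trace q m y"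
  by (simp add: trace_def sum.distrib char_power_add[OF prime] flip: power_mult)

lemma trace_zero: "q > 0 \<Longrightarrow> trace q m (0::'a) = 0"
  by (simp add: trace_def zero_power)

lemma trace_power:
  assumes "q = p ^ e" "q ^ m = p ^ d"
  shows "trace q m x ^ q = trace q m (x :: 'a)" "trace q m (x ^ q) = trace q m x"
proof -
  have "(\<Sum>i<m. x ^ (q ^ Suc i)) + x = (\<Sum>i<Suc m. x ^ (q ^ i))"
    by (subst sum.lessThan_Suc_shift) simp
  also have "\<dots> = trace q m x + x" unfolding trace_def using assms(2) by simp
  finally have *: "(\<Sum>i<m. x ^ (q ^ Suc i)) = trace q m x" by simp
  show "trace q m (x ^ q) = trace q m x"
    unfolding *[symmetric] by (simp add: trace_def flip: power_mult)
  have "trace q m x ^ q = (\<Sum>i<m. (x ^ (q ^ i)) ^ q)"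
    unfolding trace_def assms(1) by (rule char_power_sum[OF prime]) simp
  also have "\<dots> = (\<Sum>i<m. x ^ (q ^ Suc i))" by (simp add: mult.commute flip: power_mult)
  finally show "trace q m x ^ q = trace q m x" unfolding * .
qed

text \<open>Transitivity of the trace: the e m Frobenius powers are cut into m blocks of length
  e.\<close>

lemma trace_trace: "trace p (e * m) x = trace p e (trace (p ^ e) m (x :: 'a))"
proof (induction m)
  case 0
  then show ?case using trace_zero[OF p0, of e] by (simp add: trace_def)
next
  case (Suc m)
  have "trace p (e * Suc m) x = trace p (e * m) x + (\<Sum>i<e. x ^ (p ^ (e * m + i)))"
    using sum_lessThan_add[of "\<lambda>i. x ^ (p ^ i)" "e * m" e] by (simp add: trace_def add.commute)
  also have "(\<Sum>i<e. x ^ (p ^ (e * m + i))) = trace p e (x ^ ((p ^ e) ^ m))"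
    by (simp add: trace_def power_add flip: power_mult)
  also have "trace p (e * m) x + \<dots> = trace p e (trace (p ^ e) m x + x ^ ((p ^ e) ^ m))"
    unfolding Suc by (subst trace_add[of p 1]) auto
  also have "trace (p ^ e) m x + x ^ ((p ^ e) ^ m) = trace (p ^ e) (Suc m) x"
    by (simp add: trace_def)
  finally show ?case .
qed

lemma p_minus_1_dvd: "p - 1 dvd N"
  using minus_one_dvd_power_minus_one[of p d] card_N by simp

lemma prime_subfield: "{x::'a. x ^ p = x} = of_nat ` {..<p}"
proof (rule card_subset_eq[symmetric])
  have inj: "inj_on (of_nat :: nat \<Rightarrow> 'a) {..<p}"
  proof -
    have "i = j" if "i \<le> j" "j < p" "(of_nat i :: 'a) = of_nat j" for i j
    proof -
      have "(of_nat (j - i) :: 'a) = 0" using that by (simp add: of_nat_diff)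
      then have "p dvd j - i" by (simp add: of_nat_eq_0_iff)
      then show ?thesis using that by (metis diff_is_0_eq diff_le_self dvd_imp_le le_antisym
         le_less_trans linorder_not_le not_gr_zero)
    qed
    then show ?thesis unfolding inj_on_def by (metis lessThan_iff nat_le_linear)
  qed
  then show "card ((of_nat :: nat \<Rightarrow> 'a) ` {..<p}) = card {x::'a. x ^ p = x}"
    using card_subfield[OF p2 p_minus_1_dvd] by (simp add: card_image)
  have "of_nat i ^ p = (of_nat i :: 'a)" for i
    using char_power_sum[OF prime of_nat_p, of "\<lambda>_. 1" "{..<i}" 1] by simp
  then show "(of_nat :: nat \<Rightarrow> 'a) ` {..<p} \<subseteq> {x. x ^ p = x}" by auto
qed simp

text \<open>Any natural representative will do: it only serves as an exponent of
  \<open>zeta p\<close>, where its class modulo p decides.\<close>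

definition L :: "'a \<Rightarrow> nat" where "L y = (SOME i. of_nat i = y)"

lemma of_nat_L: "of_nat (L (trace p d x)) = trace p d x"
proof -
  have "trace p d x ^ p = trace p d x" by (rule trace_power[of p 1]) auto
  then have "trace p d x \<in> of_nat ` {..<p}" unfolding prime_subfield[symmetric] by simp
  then have "\<exists>i. of_nat i = trace p d x" by force
  then show ?thesis unfolding L_def by (rule someI_ex)
qed

definition \<psi> :: "'a \<Rightarrow> complex" where "\<psi> x = zeta p ^ L (trace p d x)"

lemma of_nat_cong: "of_nat i = (of_nat j :: 'a) \<Longrightarrow> [i = j] (mod p)"
proof -
  have "[i = j] (mod p)" if "i \<le> j" "of_nat i = (of_nat j :: 'a)" for i j
  proof -
    have "(of_nat (j - i) :: 'a) = 0" using that by (simp add: of_nat_diff)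
    then have "p dvd j - i" by (simp add: of_nat_eq_0_iff)
    then show ?thesis using that(1) by (meson cong_altdef_nat cong_sym)
  qed
  then show "of_nat i = (of_nat j :: 'a) \<Longrightarrow> [i = j] (mod p)" by (metis cong_sym nat_le_linear)
qed

lemma psi_add: "\<psi> (x + y) = \<psi> x * \<psi> y"
  unfolding \<psi>_def power_add[symmetric]
  by (intro zeta_power_cong of_nat_cong, unfold of_nat_add of_nat_L) (rule trace_add[of p 1], simp)

lemma psi_eq_1_iff: "\<psi> x = 1 \<longleftrightarrow> trace p d x = 0"
  unfolding \<psi>_def zeta_power_eq_1_iff[OF p0] of_nat_eq_0_iff[symmetric] of_nat_L ..

lemma psi_zero [simp]: "\<psi> 0 = 1"
  by (simp add: psi_eq_1_iff trace_zero p0)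

lemma psi_sum: "\<psi> (\<Sum>i\<in>I. h i) = (\<Prod>i\<in>I. \<psi> (h i))"
  by (induction I rule: infinite_finite_induct) (auto simp: psi_add)

lemma psi_frob: "\<psi> (x ^ p) = \<psi> x"
  unfolding \<psi>_def by (subst trace_power(2)[of p 1]) auto

lemma psi_W [simp]: "\<psi> x \<in> W"
  by (simp add: \<psi>_def zeta_p_W)

text \<open>The linear term of \<open>zeta p ^ i = (1 - \<pi>) ^ i\<close> is - i \<pi>. The trace
  thus appears as the first-order coefficient of \<psi>, which is what determines the valuation of
  \<open>gauss 1\<close>.\<close>

lemma psi_expand: "\<exists>w\<in>W. \<psi> x = 1 + \<pi> * w \<and> \<phi>' w = - trace p d x"
proof -
  have "zeta p = 1 + \<pi> * (-1)" by (simp add: \<pi>_def)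
  then have "\<phi>' (zeta p) = 1" using phi'_eq[of 1 "-1"] by (simp add: W_set.uminus_mem)
  then have z: "\<phi>' (zeta p ^ i) = 1" for i
    using W.hom_power[of "zeta p" i] zeta_p_W[of 1] by simp
  let ?w = "\<Sum>i<L (trace p d x). zeta p ^ i"
  have "?w \<in> W" by (intro W_set.sum_mem zeta_p_W)
  moreover have "\<phi>' ?w = trace p d x"
    by (simp add: W.hom_sum zeta_p_W z of_nat_L)
  moreover have "\<psi> x = 1 + \<pi> * (- ?w)" unfolding \<psi>_def by (rule zeta_p_power)
  ultimately show ?thesis by (intro bexI[of _ "- ?w"]) (auto simp: W.hom_uminus W_set.uminus_mem)
qed

text \<open>The trace is a nonzero polynomial of degree at most p^(e - 1), too small to vanish at
  all p^e elements of the subfield.\<close>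

lemma trace_nontrivial:
  assumes "e > 0" "p ^ e - 1 dvd N"
  shows "\<exists>c::'a. c ^ (p ^ e) = c \<and> trace p e c \<noteq> 0"
proof (rule ccontr)
  assume "\<not> (\<exists>c::'a. c ^ (p ^ e) = c \<and> trace p e c \<noteq> 0)"
  then have all: "trace p e c = 0" if "c ^ (p ^ e) = c" for c :: 'a using that by blast
  define h :: "'a poly" where "h = (\<Sum>i<e. monom 1 (p ^ i))"
  have "coeff h (p ^ (e - 1)) = (\<Sum>i<e. if i = e - 1 then 1 else 0)"
    unfolding h_def coeff_sum using p2 by (intro sum.cong) (auto simp: power_inject_exp)
  also have "\<dots> = 1" using assms(1) by simp
  finally have "h \<noteq> 0" by auto
  have "degree h \<le> p ^ (e - 1)"
    unfolding h_def using p0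
    by (intro degree_sum_le) (auto intro!: order.trans[OF degree_monom_le] power_increasing)
  have "q \<ge> 2" if "q = p ^ e" for q using that assms(1) p2
    by (metis power_increasing[of 1 e p] One_nat_def Suc_leI order.trans p0 power_one_right)
  then have "p ^ e = card {x::'a. x ^ (p ^ e) = x}" using card_subfield[OF _ assms(2)] by simp
  also have "\<dots> \<le> card {x. poly h x = 0}"
    using all by (intro card_mono) (auto simp: h_def poly_sum poly_monom trace_def)
  also have "\<dots> \<le> degree h" using \<open>h \<noteq> 0\<close> by (rule card_poly_roots_bound)
  also have "\<dots> \<le> p ^ (e - 1)" by fact
  also have "\<dots> < p ^ e" using assms(1) p2 by (intro power_strict_increasing) auto
  finally show False by simp
qed

lemma sum_psi_subfield:
  assumes e: "e > 0" and d: "d = e * m" and q: "q = p ^ e"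
  shows "(\<Sum>a | a ^ q = a. \<psi> (a * y)) = (if trace q m y = 0 then of_nat q else 0)"
proof -
  have qm: "q ^ m = p ^ d" by (simp add: d q power_mult)
  have q2: "q \<ge> 2" unfolding q using e p2
    by (metis power_increasing[of 1 e p] One_nat_def Suc_leI order.trans p0 power_one_right)
  have qN: "q - 1 dvd N" using minus_one_dvd_power_minus_one[of q m] qm card_N by simp
  have add: "(a + b) ^ q = a ^ q + b ^ q" for a b :: 'a
    unfolding q by (rule char_power_add[OF prime]) simp
  have lin: "trace q m (a * x) = a * trace q m x" if "a ^ q = a" for a x
  proof -
    have "a ^ (q ^ i) = a" for i by (induction i) (use that in \<open>auto simp: power_mult\<close>)
    then show ?thesis by (simp add: trace_def power_mult_distrib sum_distrib_left)
  qed
  have tr: "trace p d (a * y) = trace p e (a * trace q m y)" if "a ^ q = a" for a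
    unfolding d trace_trace using lin[OF that] q by simp
  show ?thesis
  proof (cases "trace q m y = 0")
    case True
    then have "\<psi> (a * y) = 1" if "a ^ q = a" for a
      using tr[OF that] by (simp add: psi_eq_1_iff trace_zero p0)
    then show ?thesis using True card_subfield[OF q2 qN] by simp
  next
    case False
    define z where "z = trace q m y"
    have z: "z \<noteq> 0" "z ^ q = z" using False trace_power[OF q qm] by (auto simp: z_def)
    obtain c :: 'a where c: "c ^ q = c" "trace p e c \<noteq> 0"
      using trace_nontrivial[OF e] qN unfolding q by blast
    \<comment> \<open>Normalised so that \<open>a * trace q m y = c\<close>, whence
      \<open>\<psi> (a * y) \<noteq> 1\<close> by transitivity. Translation by \<open>a\<close>
      multiplies the sum by this value, which forces the sum to be 0.\<close>
    define a where "a = c / z"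
    have a: "a ^ q = a" using c z by (simp add: a_def power_divide)
    have "\<psi> (a * y) \<noteq> 1" using tr[OF a] c z by (simp add: psi_eq_1_iff a_def flip: z_def)
    have "(\<Sum>b | b ^ q = b. \<psi> (b * y)) = (\<Sum>b | b ^ q = b. \<psi> ((b + a) * y))"
    proof (rule sum.reindex_bij_witness[of _ "\<lambda>b. b + a" "\<lambda>b. b - a"])
      fix b :: 'a assume "b \<in> {b. b ^ q = b}"
      then have "(b - a) ^ q + a = b" using add[of "b - a" a] a by simp
      then have "(b - a) ^ q = b - a" by (metis add_diff_cancel_right')
      then show "b - a \<in> {b. b ^ q = b}" by simp
    qed (auto simp: add a)
    also have "\<dots> = \<psi> (a * y) * (\<Sum>b | b ^ q = b. \<psi> (b * y))"
      unfolding sum_distrib_left distrib_right psi_add by (simp add: mult.commute)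
    finally have "(\<psi> (a * y) - 1) * (\<Sum>b | b ^ q = b. \<psi> (b * y)) = 0" by (simp add: algebra_simps)
    then show ?thesis using False \<open>\<psi> (a * y) \<noteq> 1\<close> by simp
  qed
qed

lemma sum_psi: "(\<Sum>x\<in>UNIV. \<psi> (x * y)) = (if y = 0 then of_nat (p ^ d) else 0)"
proof -
  have "{a::'a. a ^ (p ^ d) = a} = UNIV" by simp
  then show ?thesis using sum_psi_subfield[of d 1 "p ^ d" y] d_pos by (simp add: trace_def)
qed

section \<open>Gauss sums\<close>

text \<open>The Gauss sum of \<open>T ^ (- s)\<close>. For \<open>s > 0\<close> the junk value \<open>inverse 0 = 0\<close> removes the term \<open>x = 0\<close>, so
  \<open>gauss s\<close> is only meaningful for \<open>s > 0\<close>.\<close>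

definition gauss :: "nat \<Rightarrow> complex" where
  "gauss s = (\<Sum>x\<in>UNIV. T (inverse x) ^ s * \<psi> x)"

lemma T_W [simp]: "T x \<in> W"
  by (simp add: Zring_W)

lemma gauss_W: "gauss s \<in> W"
  unfolding gauss_def by (intro W_set.sum_mem W_set.mult_mem W_set.power_mem T_W psi_W)

lemma power_add_eq_0: "a > 0 \<Longrightarrow> (0::complex) ^ (a + b) = 0" for a b :: nat
  by (simp add: zero_power)

text \<open>Terms are grouped by u = x + y. For u nonzero, x = u z makes the inner sum a power of
  \<open>T (inverse u)\<close> times the Jacobi sum; for u = 0 it vanishes because N does not divide
  a + b.\<close>

lemma gauss_mult:
  assumes "a > 0" "b > 0" "\<not> N dvd (a + b)"
  shows "gauss a * gauss b = (\<Sum>z\<in>UNIV. T (inverse z) ^ a * T (inverse (1 - z)) ^ b) * gauss (a + b)" (is "_ = ?J * _")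
proof -
  define h where "h u = (\<Sum>x\<in>UNIV. T (inverse x) ^ a * T (inverse (u - x)) ^ b)" for u
  have h: "h u = T (inverse u) ^ (a + b) * ?J" for u
  proof (cases "u = 0")
    case True
    have "T (inverse x) ^ a * T (inverse (0 - x)) ^ b = T (-1) ^ b * T (inverse x) ^ (a + b)" for x
    proof -
      have "inverse (0 - x) = (-1) * inverse x" by simp
      then have "T (inverse (0 - x)) = T (-1) * T (inverse x)" by (metis T_mult)
      then show ?thesis by (simp add: power_mult_distrib power_add mult_ac)
    qed
    then have "h 0 = T (-1) ^ b * (\<Sum>x\<in>UNIV. T (inverse x) ^ (a + b))"
      unfolding h_def sum_distrib_left by simp
    also have "\<dots> = 0" unfolding sum_T_inverse sum_T using assms by auto
    finally show ?thesis using True assms by (simp add: power_add_eq_0)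
  next
    case False
    have "h u = (\<Sum>z\<in>UNIV. T (inverse (u * z)) ^ a * T (inverse (u - u * z)) ^ b)"
      unfolding h_def
      by (rule sum.reindex_bij_witness[of _ "\<lambda>z. u * z" "\<lambda>x. x / u"]) (use False in auto)
    also have "\<dots> = (\<Sum>z\<in>UNIV. T (inverse u) ^ (a + b) * (T (inverse z) ^ a * T (inverse (1 - z)) ^ b))"
    proof (rule sum.cong)
      fix z
      have "inverse (u - u * z) = inverse u * inverse (1 - z)"
        by (metis inverse_mult_distrib mult.right_neutral right_diff_distrib)
      then show "T (inverse (u * z)) ^ a * T (inverse (u - u * z)) ^ b =
          T (inverse u) ^ (a + b) * (T (inverse z) ^ a * T (inverse (1 - z)) ^ b)"
        by (simp add: T_mult power_mult_distrib power_add)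
    qed simp
    finally show ?thesis by (simp add: sum_distrib_left)
  qed
  have "gauss a * gauss b = (\<Sum>x\<in>UNIV. \<Sum>y\<in>UNIV. (T (inverse x) ^ a * T (inverse y) ^ b) * \<psi> (x + y))"
    unfolding gauss_def sum_product psi_add by (intro sum.cong) (simp_all add: mult_ac)
  also have "\<dots> = (\<Sum>x\<in>UNIV. \<Sum>u\<in>UNIV. (T (inverse x) ^ a * T (inverse (u - x)) ^ b) * \<psi> u)"
  proof (rule sum.cong)
    fix x
    show "(\<Sum>y\<in>UNIV. (T (inverse x) ^ a * T (inverse y) ^ b) * \<psi> (x + y)) =
      (\<Sum>u\<in>UNIV. (T (inverse x) ^ a * T (inverse (u - x)) ^ b) * \<psi> u)"
      by (rule sum.reindex_bij_witness[of _ "\<lambda>u. u - x" "\<lambda>y. x + y"]) auto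
  qed simp
  also have "\<dots> = (\<Sum>u\<in>UNIV. h u * \<psi> u)"
    unfolding h_def sum_distrib_right by (rule sum.swap)
  also have "\<dots> = ?J * gauss (a + b)"
    unfolding h gauss_def sum_distrib_left[of ?J] by (intro sum.cong) (simp_all add: mult_ac)
  finally show ?thesis .
qed

lemma T_inverse_power:
  assumes "0 < s" "s < N" shows "T (inverse x) ^ (N - s) = T x ^ s"
proof (cases "x = 0")
  case False
  then have "T (inverse x) ^ (N - s) * T (inverse x) ^ s = 1"
    using assms T_power_N[of "inverse x"] by (simp flip: power_add)
  moreover have "T (inverse x) ^ s * T x ^ s = 1"
    using False by (simp flip: power_mult_distrib T_mult)
  ultimately show ?thesis by (metis mult.assoc mult.left_neutral mult.right_neutral)
qed (use assms in \<open>simp add: zero_power\<close>)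

text \<open>The relation |g|^2 = p^d without complex conjugation. After y = x z, the sum of
  \<open>\<psi> (x * (1 + z))\<close> over nonzero x is -1 plus a term at z = -1, and the constant
  -1 is killed by the vanishing sum of \<open>T z ^ s\<close>.\<close>

lemma gauss_reflect:
  assumes "0 < s" "s < N"
  shows "gauss s * gauss (N - s) = T (-1) ^ s * of_nat (p ^ d)"
proof -
  have Ns: "\<not> N dvd s" using assms by (auto dest: dvd_imp_le)
  have split: "(\<Sum>x\<in>UNIV. F x) = F 0 + (\<Sum>x\<in>UNIV - {0}. F x)" for F :: "'a \<Rightarrow> complex"
    by (rule sum.remove) auto
  have "gauss s * gauss (N - s) = (\<Sum>x\<in>UNIV. \<Sum>y\<in>UNIV. T (inverse x) ^ s * T y ^ s * \<psi> (x + y))"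
    unfolding gauss_def T_inverse_power[OF assms] sum_product psi_add by (intro sum.cong) (simp_all add: mult_ac)
  also have "\<dots> = (\<Sum>x\<in>UNIV - {0}. \<Sum>y\<in>UNIV. T (inverse x) ^ s * T y ^ s * \<psi> (x + y))"
    unfolding split[of "\<lambda>x. \<Sum>y\<in>UNIV. T (inverse x) ^ s * T y ^ s * \<psi> (x + y)"]
    using assms by (simp add: zero_power)
  also have "\<dots> = (\<Sum>x\<in>UNIV - {0}. \<Sum>z\<in>UNIV. T z ^ s * \<psi> (x * (1 + z)))"
  proof (rule sum.cong)
    fix x :: 'a assume "x \<in> UNIV - {0}"
    then have x: "x \<noteq> 0" by simp
    have "(\<Sum>y\<in>UNIV. T (inverse x) ^ s * T y ^ s * \<psi> (x + y)) =
      (\<Sum>z\<in>UNIV. T (inverse x) ^ s * T (x * z) ^ s * \<psi> (x + x * z))"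
      by (rule sum.reindex_bij_witness[of _ "\<lambda>z. x * z" "\<lambda>y. y / x"]) (use x in auto)
    also have "\<dots> = (\<Sum>z\<in>UNIV. T z ^ s * \<psi> (x * (1 + z)))"
      using x by (intro sum.cong) (auto simp: T_mult T_inverse power_mult_distrib distrib_left power_inverse)
    finally show "(\<Sum>y\<in>UNIV. T (inverse x) ^ s * T y ^ s * \<psi> (x + y)) = \<dots>" .
  qed simp
  also have "\<dots> = (\<Sum>z\<in>UNIV. T z ^ s * (\<Sum>x\<in>UNIV - {0}. \<psi> (x * (1 + z))))"
    unfolding sum_distrib_left by (rule sum.swap)
  also have "\<dots> = (\<Sum>z\<in>UNIV. T z ^ s * ((if z = -1 then of_nat (p ^ d) else 0) - 1))"
  proof (rule sum.cong)
    fix z :: 'a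
    have "(\<Sum>x\<in>UNIV - {0}. \<psi> (x * (1 + z))) = (if 1 + z = 0 then of_nat (p ^ d) else 0) - 1"
      using split[of "\<lambda>x. \<psi> (x * (1 + z))"] sum_psi[of "1 + z"] by (simp add: algebra_simps)
    then show "T z ^ s * (\<Sum>x\<in>UNIV - {0}. \<psi> (x * (1 + z))) =
        T z ^ s * ((if z = -1 then of_nat (p ^ d) else 0) - 1)"
      by (simp add: add_eq_0_iff2 add.commute[of 1])
  qed simp
  also have "\<dots> = (\<Sum>z\<in>UNIV. if z = -1 then T z ^ s * of_nat (p ^ d) else 0) - (\<Sum>z\<in>UNIV. T z ^ s)"
    unfolding sum_subtractf[symmetric] by (intro sum.cong) (auto simp: algebra_simps)
  also have "\<dots> = T (-1) ^ s * of_nat (p ^ d)"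
    using Ns assms by (simp add: sum_T)
  finally show ?thesis .
qed

text \<open>The p-th power map permutes the field and preserves \<psi>. This removes trailing zero
  digits of the exponent.\<close>

lemma gauss_frob: "gauss (p * s) = gauss s"
proof -
  have "inj (\<lambda>x::'a. x ^ p)"
  proof (rule injI)
    fix x y :: 'a assume "x ^ p = y ^ p"
    then have "(x ^ p) ^ (p ^ (d - 1)) = (y ^ p) ^ (p ^ (d - 1))" by simp
    moreover have "p * p ^ (d - 1) = p ^ d" using d_pos by (cases d) auto
    ultimately show "x = y" by (simp flip: power_mult)
  qed
  then have bij: "bij (\<lambda>x::'a. x ^ p)" by (simp add: bij_def finite_UNIV_inj_surj)
  have "gauss s = (\<Sum>x\<in>UNIV. T (inverse (x ^ p)) ^ s * \<psi> (x ^ p))"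
    unfolding gauss_def using sum.reindex_bij_betw[OF bij, of "\<lambda>x. T (inverse x) ^ s * \<psi> x"] by simp
  also have "\<dots> = gauss (p * s)"
    by (simp add: gauss_def psi_frob T_power power_mult flip: power_inverse)
  finally show ?thesis ..
qed

lemma sum_power_field:
  "(\<Sum>x\<in>UNIV. x ^ s) = (if s = 0 then 0 else if N dvd s then -1 else (0::'a))"
proof -
  have "(\<Sum>x\<in>UNIV. x ^ s) = \<phi> (\<Sum>x\<in>UNIV. T x ^ s)"
    by (simp add: R.hom_sum R.power_mem R.hom_power)
  then show ?thesis using d_pos R.hom_of_nat[of "p ^ d"] R.hom_of_nat[of N] by (auto simp: sum_T zero_power simp del: R.hom_of_nat)
qed

text \<open>The constant term of \<psi> contributes 0 since N > 1. The coefficient of \<pi> reduces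
  to minus the sum of \<open>inverse x * trace p d x\<close>, hence to power sums with exponents p^i
  - 1; only i = 0 survives and yields 1.\<close>

lemma veq_gauss_1:
  assumes "N > 1" shows "W.veq 1 (gauss 1)"
proof -
  obtain w where w: "\<And>x. w x \<in> W" "\<And>x. \<psi> x = 1 + \<pi> * w x" "\<And>x. \<phi>' (w x) = - trace p d x"
    using psi_expand by metis
  have "gauss 1 = (\<Sum>x\<in>UNIV. T (inverse x) ^ 1) + \<pi> * (\<Sum>x\<in>UNIV. T (inverse x) * w x)"
    by (simp add: gauss_def w(2) distrib_left sum.distrib sum_distrib_left mult_ac)
  also have "(\<Sum>x\<in>UNIV. T (inverse x) ^ 1) = 0"
    unfolding sum_T_inverse sum_T using assms by simp
  finally have g1: "gauss 1 = \<pi> ^ 1 * (\<Sum>x\<in>UNIV. T (inverse x) * w x)" by simp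
  have "\<phi>' (\<Sum>x\<in>UNIV. T (inverse x) * w x) = (\<Sum>x\<in>UNIV. - (inverse x * trace p d x))"
    using w by (simp add: W.hom_sum W_set.mult_mem W.hom_mult phi'_eq_phi)
  also have "\<dots> = - (\<Sum>i<d. \<Sum>x\<in>UNIV. inverse x * x ^ (p ^ i))"
    unfolding trace_def sum_distrib_left sum_negf by (subst sum.swap) simp
  also have "(\<Sum>i<d. \<Sum>x\<in>UNIV. inverse x * x ^ (p ^ i)) = (\<Sum>i<d. if i = 0 then -1 else (0::'a))"
  proof (rule sum.cong)
    fix i assume i: "i \<in> {..<d}"
    show "(\<Sum>x\<in>UNIV. inverse x * x ^ (p ^ i)) = (if i = 0 then -1 else (0::'a))"
    proof (cases "i = 0")
      case True
      have "(\<Sum>x\<in>UNIV. inverse x * x :: 'a) = (\<Sum>x\<in>(UNIV::'a set). if x = 0 then 0 else 1)"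
        by (intro sum.cong) auto
      also have "\<dots> = (\<Sum>x\<in>UNIV - {0::'a}. 1)" by (rule sum.mono_neutral_cong_right) auto
      also have "\<dots> = of_nat N" by (simp add: N_def)
      finally show ?thesis using True by simp
    next
      case False
      have pi: "p ^ i > 1" using False p2 by (intro one_less_power) auto
      have "p ^ i < p ^ d" using i p2 by (intro power_strict_increasing) auto
      then have "\<not> N dvd p ^ i - 1" using pi card_N by (auto dest: dvd_imp_le)
      moreover have "inverse x * x ^ (p ^ i) = x ^ (p ^ i - 1)" for x :: 'a
        using pi by (cases "x = 0"; cases "p ^ i") (auto simp: zero_power)
      ultimately show ?thesis using False sum_power_field[of "p ^ i - 1"] by simp
    qed
  qed simp
  finally have "\<phi>' (\<Sum>x\<in>UNIV. T (inverse x) * w x) = 1" using d_pos by simp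
  moreover have "(\<Sum>x\<in>UNIV. T (inverse x) * w x) \<in> W"
    using w by (intro W_set.sum_mem W_set.mult_mem T_W)
  ultimately show ?thesis unfolding g1 by (intro W.veqI) auto
qed

lemma W_veq_unit_T: "x \<noteq> 0 \<Longrightarrow> W.veq 0 (T x)"
  by (intro W.veq_0I) (auto simp: phi'_eq_phi)

lemma W_veq_card: "W.veq ((p - 1) * d) (of_nat (p ^ d))"
  using W.veq_power[OF W_veq_p, of d] by simp

lemma veq_gauss_ex:
  assumes "0 < s" "s < N"
  shows "\<exists>v v'. W.veq v (gauss s) \<and> W.veq v' (gauss (N - s)) \<and> v + v' = (p - 1) * d"
proof -
  have "W.veq (0 * s + (p - 1) * d) (T (-1) ^ s * of_nat (p ^ d))"
    by (intro W.veq_mult W.veq_power W_veq_unit_T W_veq_card) simp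
  then have "W.veq ((p - 1) * d) (gauss s * gauss (N - s))" using gauss_reflect[OF assms] by simp
  then show ?thesis by (rule W.veq_factors) (auto intro: W.vge_0I gauss_W)
qed

text \<open>Removing a digit from \<open>s\<close> costs at most one, because Jacobi sums are integral. Equality follows in
  \<open>stickelberger\<close>, as both the valuations and the digit sums of \<open>s\<close> and \<open>N - s\<close> add up to \<open>(p - 1) d\<close>.\<close>

lemma veq_gauss_le:
  assumes "0 < s" "s < N"
  shows "\<exists>v\<le>digit_sum p s. W.veq v (gauss s)"
  using assms
proof (induction s rule: less_induct)
  case (less s)
  show ?case
  proof (cases "p dvd s")
    case True
    then obtain t where t: "s = p * t" by blast
    then have "0 < t" "t < s" using less.prems p2 by auto
    then have "\<exists>v\<le>digit_sum p t. W.veq v (gauss t)" using less by simp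
    then show ?thesis unfolding t gauss_frob digit_sum_mult[OF p2] .
  next
    case False
    show ?thesis
    proof (cases "s = 1")
      case True
      then show ?thesis using veq_gauss_1 less.prems digit_sum_1[OF p2] by auto
    next
      case False
      obtain b where b: "s = Suc b" using less.prems by (cases s) auto
      then have "b > 0" using False by simp
      obtain v where v: "v \<le> digit_sum p b" "W.veq v (gauss b)" using less b \<open>b > 0\<close> by force
      have ds: "digit_sum p s = Suc (digit_sum p b)"
        unfolding b by (rule digit_sum_Suc) (use p2 \<open>\<not> p dvd s\<close> b in auto)
      have "W.veq (1 + v) (gauss 1 * gauss b)"
        using v less.prems b \<open>b > 0\<close> by (intro W.veq_mult veq_gauss_1) auto
      moreover have "\<not> N dvd 1 + b" using less.prems b by (auto dest: dvd_imp_le)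
      ultimately have "W.veq (1 + v)
          ((\<Sum>z\<in>UNIV. T (inverse z) ^ 1 * T (inverse (1 - z)) ^ b) * gauss (1 + b))"
        using gauss_mult[of 1 b] \<open>b > 0\<close> by simp
      then obtain v1 v2 where "W.veq v2 (gauss (1 + b))" "v1 + v2 = 1 + v"
        by (rule W.veq_factors)
          (auto intro!: W.vge_0I gauss_W W_set.sum_mem W_set.mult_mem W_set.power_mem)
      then show ?thesis using ds v b by (intro exI[of _ v2]) auto
    qed
  qed
qed

theorem stickelberger:
  assumes "0 < s" "s < N"
  shows "W.veq (digit_sum p s) (gauss s)"
proof -
  obtain v v' where v: "W.veq v (gauss s)" "W.veq v' (gauss (N - s))" "v + v' = (p - 1) * d"
    using veq_gauss_ex[OF assms] by blast
  have "v \<le> digit_sum p s" using veq_gauss_le[OF assms] v W.veq_unique by blast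
  moreover have "v' \<le> digit_sum p (N - s)" using veq_gauss_le[of "N - s"] assms v W.veq_unique by auto
  moreover have "digit_sum p (N - s) + digit_sum p s = (p - 1) * d"
    using digit_sum_complement[OF p2, of s d] assms card_N by simp
  ultimately have "v = digit_sum p s" using v(3) by simp
  then show ?thesis using v by simp
qed

section \<open>Expansion in Teichmueller monomials\<close>

text \<open>The basis dual to the monomials \<open>T x ^ s\<close> with \<open>s \<le> N\<close>.\<close>

definition D :: "nat \<Rightarrow> 'a \<Rightarrow> complex" where
  "D s x = (if s = 0 then of_bool (x = 0)
            else T (inverse x) ^ s / of_nat N - of_bool (s = N \<and> x = 0))"

text \<open>Off 0 this is orthogonality of characters. The monomials with exponents 0 and N differ
  only at x = 0, hence the indicator of 0 in \<open>D 0\<close> and its subtraction in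
  \<open>D N\<close>.\<close>

lemma sum_D_T:
  assumes "r \<le> N" "s \<le> N"
  shows "(\<Sum>x\<in>UNIV. D s x * T x ^ r) = of_bool (r = s)"
proof (cases "s = 0")
  case True
  have "(\<Sum>x\<in>UNIV. D s x * T x ^ r) = (\<Sum>x\<in>UNIV. if x = 0 then T x ^ r else 0)"
    using True by (intro sum.cong) (auto simp: D_def)
  then show ?thesis using True by (cases r) auto
next
  case s: False
  have "(\<Sum>x\<in>UNIV. D s x * T x ^ r) =
      (\<Sum>x\<in>UNIV. T (inverse x) ^ s * T x ^ r) / of_nat N - (\<Sum>x\<in>UNIV. if x = 0 then of_bool (s = N) * T x ^ r else 0)"
    unfolding sum_divide_distrib sum_subtractf[symmetric]
    using s by (intro sum.cong) (auto simp: D_def left_diff_distrib)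
  also have "(\<Sum>x\<in>UNIV. T (inverse x) ^ s * T x ^ r) =
      (if r = 0 then of_nat N * of_bool (s = N) else of_nat N * of_bool (r = s))"
  proof (cases "r = 0")
    case True
    have "N dvd s \<longleftrightarrow> s = N" using assms s by (auto dest: dvd_imp_le)
    then show ?thesis using True s sum_T[of s] by (auto simp: sum_T_inverse)
  next
    case False
    have "T (inverse x) ^ s * T x ^ r = T x ^ (N - s + r)" for x
    proof (cases "x = 0")
      case x: False
      have "T (inverse x) ^ s * T x ^ s = 1"
        using x by (simp flip: power_mult_distrib T_mult)
      moreover have "T x ^ (N - s) * T x ^ s = 1"
        using x assms T_power_N[of x] by (simp flip: power_add)
      ultimately have "T (inverse x) ^ s = T x ^ (N - s)"
        using x by (metis T_eq_0_iff mult_right_cancel power_not_zero)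
      then show ?thesis by (simp add: power_add)
    qed (use s False in \<open>simp add: zero_power\<close>)
    \<comment> \<open>As r and s lie in [1, N], the number N - s + r lies strictly between 0 and 2
      N.\<close>
    moreover have "N dvd N - s + r \<longleftrightarrow> r = s"
    proof
      assume "N dvd N - s + r"
      then obtain c where c: "N - s + r = N * c" by blast
      have "N - s + r < N * 2" "0 < N - s + r" using s False assms by linarith+
      then have "N * c < N * 2" "0 < N * c" unfolding c by auto
      then have "c = 1" by (cases c) auto
      then show "r = s" using c assms by simp
    qed (use assms in simp)
    ultimately show ?thesis using False by (simp add: sum_T)
  qed
  finally show ?thesis using s by (cases "r = 0") auto
qed

text \<open>The inversion in the other order: it expands functions into monomials, while
  \<open>sum_D_T\<close> recovers coefficients.\<close>

lemma sum_D_T':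
  "(\<Sum>s\<le>N. D s x * T y ^ s) = of_bool (x = y)"
proof -
  have ins: "{..N} = insert 0 {1..N}" by auto
  have "(\<Sum>s\<le>N. D s x * T y ^ s) = of_bool (x = 0) + (\<Sum>s=1..N. D s x * T y ^ s)"
    unfolding ins by (simp add: D_def)
  also have "(\<Sum>s=1..N. D s x * T y ^ s) =
      (\<Sum>s=1..N. T (inverse x * y) ^ s) / of_nat N - (\<Sum>s=1..N. if s = N then of_bool (x = 0) * T y ^ s else 0)"
    unfolding sum_divide_distrib sum_subtractf[symmetric]
    by (intro sum.cong) (auto simp: D_def T_mult power_mult_distrib algebra_simps)
  also have "(\<Sum>s=1..N. if s = N then of_bool (x = 0) * T y ^ s else 0) = of_bool (x = 0) * T y ^ N"
    using N_pos by simp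
  also have "(\<Sum>s=1..N. T (inverse x * y) ^ s) = of_nat N * of_bool (x = y \<and> x \<noteq> 0)"
  proof (cases "x = 0 \<or> y = 0")
    case True
    then show ?thesis by (auto simp: zero_power)
  next
    case False
    define w where "w = T (inverse x * y)"
    have wN: "w ^ N = 1" unfolding w_def by (rule T_power_N) (use False in simp)
    have w1: "w = 1 \<longleftrightarrow> x = y"
      unfolding w_def using False T_eq_iff[of "inverse x * y" 1] by (auto simp: field_simps)
    have "(\<Sum>s=1..N. w ^ s) = (\<Sum>s<N. w ^ Suc s)"
      by (rule sum.reindex_bij_witness[of _ Suc "\<lambda>s. s - 1"]) auto
    also have "\<dots> = w * (\<Sum>s<N. w ^ s)" by (simp add: sum_distrib_left)
    also have "\<dots> = of_nat N * of_bool (x = y \<and> x \<noteq> 0)"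
      using sum_root_of_unity[OF wN] w1 False by (cases "x = y") auto
    finally show ?thesis unfolding w_def .
  qed
  finally show ?thesis by (cases "x = 0"; cases "y = 0") (auto simp: T_power_N)
qed

lemma D_vge: "W.vge 0 (D s x)"
proof -
  have "W.veq 0 (of_nat N * (1 / of_nat N))" using W.veq_one by simp
  then have "W.veq 0 (1 / of_nat N)" by (rule W.veq_cancel_unit) auto
  then have *: "W.vge 0 (T (inverse x) ^ s * (1 / of_nat N))"
    by (intro W.vge_mult_left W.veq_imp_vge W.vge_0I W_set.power_mem T_W)
  show ?thesis
  proof (cases "s = 0")
    case True
    then show ?thesis by (auto simp: D_def intro: W.vge_0I)
  next
    case False
    then have "D s x = T (inverse x) ^ s * (1 / of_nat N) + - of_nat (of_bool (s = N \<and> x = 0))"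
      by (simp add: D_def)
    also have "W.vge 0 \<dots>" using * by (intro W.vge_add W.vge_0I[OF W_set.uminus_mem]) auto
    finally show ?thesis .
  qed
qed

definition C :: "nat \<Rightarrow> complex" where "C s = (\<Sum>x\<in>UNIV. D s x * \<psi> x)"

lemma psi_eq_sum_C: "\<psi> y = (\<Sum>s\<le>N. C s * T y ^ s)"
proof -
  have "(\<Sum>s\<le>N. C s * T y ^ s) = (\<Sum>s\<le>N. \<Sum>x\<in>UNIV. \<psi> x * (D s x * T y ^ s))"
    unfolding C_def sum_distrib_right by (simp add: mult_ac)
  also have "\<dots> = (\<Sum>x\<in>UNIV. \<psi> x * (\<Sum>s\<le>N. D s x * T y ^ s))"
    unfolding sum_distrib_left by (rule sum.swap)
  also have "\<dots> = (\<Sum>x\<in>UNIV. if x = y then \<psi> x else 0)"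
    unfolding sum_D_T' by (intro sum.cong) auto
  finally show ?thesis by simp
qed

lemma C_0: "C 0 = 1"
proof -
  have "C 0 = (\<Sum>x\<in>UNIV. if x = 0 then \<psi> x else 0)"
    unfolding C_def by (intro sum.cong) (auto simp: D_def)
  then show ?thesis by simp
qed

lemma C_pos: "s > 0 \<Longrightarrow> of_nat N * C s = gauss s - of_nat N * of_bool (s = N)"
proof -
  assume s: "s > 0"
  have "C s = (\<Sum>x\<in>UNIV. T (inverse x) ^ s * \<psi> x / of_nat N) - (\<Sum>x\<in>(UNIV::'a set). if x = 0 then of_bool (s = N) else 0)"
    unfolding C_def sum_subtractf[symmetric]
    using s by (intro sum.cong) (auto simp: D_def algebra_simps)
  then show ?thesis
    by (simp add: gauss_def field_simps flip: sum_divide_distrib)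
qed

lemma gauss_N: "gauss N = -1"
proof -
  have "gauss N = (\<Sum>x\<in>UNIV - {0}. \<psi> x)"
    unfolding gauss_def by (rule sum.mono_neutral_cong_right) (auto simp: T_power_N zero_power)
  also have "\<dots> = (\<Sum>x\<in>UNIV. \<psi> x) - \<psi> 0" by (simp add: sum_diff)
  also have "\<dots> = -1" using sum_psi[of 1] by simp
  finally show ?thesis .
qed

text \<open>Inside the range this is Stickelberger up to the unit N. At s = N the Gauss sum is the
  unit -1, but the correction in \<open>D N\<close> changes it to -1 - N = - p^d, whose value is the
  digit sum of N.\<close>

lemma veq_C:
  assumes "s \<le> N" shows "W.veq (digit_sum p s) (C s)"
proof -
  consider "s = 0" | "0 < s" "s < N" | "s = N" "0 < s" using assms by linarith
  then show ?thesis
  proof cases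
    case 1
    then show ?thesis using C_0 W.veq_one by simp
  next
    case 2
    then have "W.veq (digit_sum p s) (of_nat N * C s)" using stickelberger C_pos by simp
    then show ?thesis by (rule W.veq_cancel_unit) auto
  next
    case 3
    have "of_nat N * C s = -1 * of_nat (p ^ d)" using 3 C_pos[of s] gauss_N card_N by simp
    moreover have "W.veq (0 + (p - 1) * d) (-1 * of_nat (p ^ d))"
      by (intro W.veq_mult W.veq_0I W_veq_card) (auto simp: W.hom_uminus W_set.uminus_mem)
    ultimately have "W.veq ((p - 1) * d) (of_nat N * C s)" by simp
    then have "W.veq ((p - 1) * d) (C s)" by (rule W.veq_cancel_unit) auto
    moreover have "digit_sum p s = (p - 1) * d"
      using digit_sum_complement[OF p2, of s d] 3 card_N by simp
    ultimately show ?thesis by simp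
  qed
qed

end

section \<open>Divisibility of trace codes\<close>

locale trace_code_setup = teichmuller p d N \<phi>
  for p d N and \<phi> :: "complex \<Rightarrow> 'a::{field,finite}" +
  fixes e m n k q :: nat and G :: "nat \<Rightarrow> nat \<Rightarrow> 'a"
  assumes e_pos: "e > 0" and d_eq: "d = e * m" and q_def: "q = p ^ e"
begin

lemma q2: "q \<ge> 2"
  unfolding q_def using e_pos p2
  by (metis power_increasing[of 1 e p] One_nat_def Suc_leI order.trans p0 power_one_right)

lemma q_dvd: "q - 1 dvd N"
  using minus_one_dvd_power_minus_one[of q m] card_N by (simp add: q_def d_eq power_mult)

definition \<Omega> where "\<Omega> = (PiE {..<k} (\<lambda>_. {..N}))"

lemma finite_Omega: "finite \<Omega>"
  unfolding \<Omega>_def by (intro finite_PiE) auto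

definition cword :: "(nat \<Rightarrow> 'a) \<Rightarrow> nat \<Rightarrow> 'a" where "cword x j = (\<Sum>i<k. x i * G i j)"

definition wt :: "(nat \<Rightarrow> 'a) \<Rightarrow> nat" where
  "wt x = card {j. j < n \<and> trace q m (cword x j) \<noteq> 0}"

definition \<Gamma> :: "(nat \<Rightarrow> nat) \<Rightarrow> complex" where
  "\<Gamma> r = (\<Sum>j<n. \<Prod>i<k. T (G i j) ^ r i)"

text \<open>For t > 0 this is q - 1 if q - 1 divides t and 0 otherwise, which is the source of the
  congruence condition on |r|.\<close>

definition A :: "nat \<Rightarrow> complex" where "A t = (\<Sum>a | a ^ q = a. T a ^ t)"

text \<open>The coefficients of \<open>- q wt x\<close>; the contribution of the exponent \<open>0\<close> is \<open>q n\<close>, which cancels.\<close>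

definition B :: "(nat \<Rightarrow> nat) \<Rightarrow> complex" where
  "B r = (if (\<Sum>i<k. r i) = 0 then 0 else A (\<Sum>i<k. r i) * (\<Prod>i<k. C (r i)) * \<Gamma> r)"

lemma psi_expansion:
  "\<psi> (a * cword x j) = (\<Sum>r\<in>\<Omega>. T a ^ (\<Sum>i<k. r i) * (\<Prod>i<k. C (r i)) * (\<Prod>i<k. T (G i j) ^ r i) *
     (\<Prod>i<k. T (x i) ^ r i))"
proof -
  have "\<psi> (a * cword x j) = (\<Prod>i<k. \<psi> (a * (x i * G i j)))"
    unfolding cword_def sum_distrib_left psi_sum ..
  also have "\<dots> = (\<Prod>i<k. \<Sum>s\<le>N. C s * T (a * (x i * G i j)) ^ s)"
    by (simp only: psi_eq_sum_C[symmetric])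
  also have "\<dots> = (\<Sum>r\<in>\<Omega>. \<Prod>i<k. C (r i) * T (a * (x i * G i j)) ^ r i)"
    unfolding \<Omega>_def by (rule prod_sum_PiE) auto
  also have "\<dots> = (\<Sum>r\<in>\<Omega>. T a ^ (\<Sum>i<k. r i) * (\<Prod>i<k. C (r i)) * (\<Prod>i<k. T (G i j) ^ r i) *
     (\<Prod>i<k. T (x i) ^ r i))"
    by (simp add: T_mult power_mult_distrib prod.distrib power_sum mult_ac)
  finally show ?thesis .
qed

text \<open>Summing \<open>\<psi> (a * cword x j)\<close> over a in the subfield and over j counts
  each zero of the trace word q times. Expanding \<psi> first and summing over a and j last produces
  \<open>A\<close> and \<Gamma>.\<close>

lemma weight_expansion:
  "- of_nat (q * wt x) = (\<Sum>r\<in>\<Omega>. B r * (\<Prod>i<k. T (x i) ^ r i))"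
proof -
  define E where "E r = A (\<Sum>i<k. r i) * (\<Prod>i<k. C (r i)) * \<Gamma> r" for r
  have "(\<Sum>j<n. \<Sum>a | a ^ q = a. \<psi> (a * cword x j)) = (\<Sum>j<n. if trace q m (cword x j) = 0 then of_nat q else 0)"
    unfolding sum_psi_subfield[OF e_pos d_eq q_def] ..
  also have "\<dots> = (\<Sum>j<n. of_nat q - (if trace q m (cword x j) \<noteq> 0 then of_nat q else 0))"
    by (intro sum.cong) auto
  also have "\<dots> = of_nat n * of_nat q - of_nat (q * wt x)"
  proof -
    have "{..<n} \<inter> {j. trace q m (cword x j) \<noteq> 0} = {j. j < n \<and> trace q m (cword x j) \<noteq> 0}" by auto
    then show ?thesis
      by (simp only: sum_subtractf sum.inter_restrict[symmetric] sum.If_cases finite_lessThan) (simp add: wt_def mult.commute)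
  qed
  finally have 1: "(\<Sum>j<n. \<Sum>a | a ^ q = a. \<psi> (a * cword x j)) = of_nat n * of_nat q - of_nat (q * wt x)" .
  have "(\<Sum>j<n. \<Sum>a | a ^ q = a. \<psi> (a * cword x j)) =
     (\<Sum>j<n. \<Sum>r\<in>\<Omega>. \<Sum>a | a ^ q = a. T a ^ (\<Sum>i<k. r i) * (\<Prod>i<k. C (r i)) * (\<Prod>i<k. T (G i j) ^ r i) *
     (\<Prod>i<k. T (x i) ^ r i))"
    unfolding psi_expansion by (intro sum.cong refl sum.swap)
  also have "\<dots> = (\<Sum>r\<in>\<Omega>. \<Sum>j<n. A (\<Sum>i<k. r i) * (\<Prod>i<k. C (r i)) * (\<Prod>i<k. T (G i j) ^ r i) *
     (\<Prod>i<k. T (x i) ^ r i))"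
    unfolding A_def sum_distrib_right by (rule sum.swap)
  also have "\<dots> = (\<Sum>r\<in>\<Omega>. E r * (\<Prod>i<k. T (x i) ^ r i))"
    unfolding E_def \<Gamma>_def by (simp only: sum_distrib_left sum_distrib_right)
  also have "\<dots> = (\<Sum>r\<in>\<Omega>. B r * (\<Prod>i<k. T (x i) ^ r i) + (if r = (\<lambda>i\<in>{..<k}. 0) then of_nat n * of_nat q else 0))"
  proof (rule sum.cong)
    fix r assume r: "r \<in> \<Omega>"
    show "E r * (\<Prod>i<k. T (x i) ^ r i) =
        B r * (\<Prod>i<k. T (x i) ^ r i) + (if r = (\<lambda>i\<in>{..<k}. 0) then of_nat n * of_nat q else 0)"
    proof (cases "(\<Sum>i<k. r i) = 0")
      case True
      then have z: "r i = 0" if "i < k" for i using that by simp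
      then have "r = (\<lambda>i\<in>{..<k}. 0)"
        using r unfolding \<Omega>_def by (intro ext) (auto simp: PiE_def extensional_def)
      moreover have "E r = of_nat n * of_nat q"
        using z sum_T_subfield[OF q2 q_dvd, of 0] True by (simp add: E_def C_0 \<Gamma>_def A_def)
      ultimately show ?thesis using z True by (simp add: B_def)
    next
      case False
      then have "r \<noteq> (\<lambda>i\<in>{..<k}. 0)" by auto
      moreover have "B r = E r" unfolding B_def E_def by (rule if_not_P[OF False])
      ultimately show ?thesis by simp
    qed
  qed simp
  also have "\<dots> = (\<Sum>r\<in>\<Omega>. B r * (\<Prod>i<k. T (x i) ^ r i)) + of_nat n * of_nat q"
  proof -
    have "(\<lambda>i\<in>{..<k}. 0) \<in> \<Omega>" unfolding \<Omega>_def by auto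
    then show ?thesis by (simp add: sum.distrib finite_Omega)
  qed
  finally have 2: "of_nat n * of_nat q - of_nat (q * wt x) =
      (\<Sum>r\<in>\<Omega>. B r * (\<Prod>i<k. T (x i) ^ r i)) + of_nat n * of_nat q" unfolding 1 .
  show ?thesis
    by (rule add_right_imp_eq[of _ "of_nat n * of_nat q"], unfold 2[symmetric]) (simp only: uminus_add_conv_diff)
qed

text \<open>Products of the \<open>D s\<close> are dual to the multivariate monomials, since the sum
  over all x factors coordinatewise.\<close>

lemma coefficient_inversion:
  assumes r: "r \<in> \<Omega>"
  shows "B r = (\<Sum>x\<in>PiE {..<k} (\<lambda>_. UNIV). (\<Prod>i<k. D (r i) (x i)) * - of_nat (q * wt x))"
proof -
  have "(\<Sum>x\<in>PiE {..<k} (\<lambda>_. UNIV). (\<Prod>i<k. D (r i) (x i)) * - of_nat (q * wt x)) =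
     (\<Sum>x\<in>PiE {..<k} (\<lambda>_. UNIV). \<Sum>s\<in>\<Omega>. B s * (\<Prod>i<k. D (r i) (x i) * T (x i) ^ s i))"
    unfolding weight_expansion sum_distrib_left prod.distrib by (simp add: mult_ac)
  also have "\<dots> = (\<Sum>s\<in>\<Omega>. B s * (\<Sum>x\<in>PiE {..<k} (\<lambda>_. UNIV). \<Prod>i<k. D (r i) (x i) * T (x i) ^ s i))"
    unfolding sum_distrib_left by (rule sum.swap)
  also have "\<dots> = (\<Sum>s\<in>\<Omega>. if s = r then B s else 0)"
  proof (rule sum.cong)
    fix s assume s: "s \<in> \<Omega>"
    have "(\<Sum>x\<in>PiE {..<k} (\<lambda>_. UNIV). \<Prod>i<k. D (r i) (x i) * T (x i) ^ s i) =
       (\<Prod>i<k. \<Sum>x\<in>UNIV. D (r i) x * T x ^ s i)"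
      by (rule prod_sum_PiE[symmetric]) auto
    also have "\<dots> = (\<Prod>i<k. of_bool (s i = r i))"
      using r s by (intro prod.cong sum_D_T) (auto simp: \<Omega>_def PiE_iff)
    also have "\<dots> = of_bool (s = r)"
    proof (cases "s = r")
      case False
      then obtain i where "i < k" "s i \<noteq> r i"
        using r s unfolding \<Omega>_def by (metis PiE_ext lessThan_iff)
      then show ?thesis using False by (auto intro!: prod_zero)
    qed simp
    finally show "B s * (\<Sum>x\<in>PiE {..<k} (\<lambda>_. UNIV). \<Prod>i<k. D (r i) (x i) * T (x i) ^ s i) = (if s = r then B s else 0)"
      by simp
  qed simp
  also have "\<dots> = B r" using r finite_Omega by simp
  finally show ?thesis ..
qed

text \<open>Both directions of the transform have locally integral coefficients, so neither can
  lower a common bound. The shift from t to t + e accounts for the factor q.\<close>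

lemma vge_weights_iff:
  "(\<forall>x. p ^ t dvd wt x) \<longleftrightarrow> (\<forall>r\<in>\<Omega>. W.vge ((p - 1) * (t + e)) (B r))"
proof -
  have iff: "p ^ t dvd wt x \<longleftrightarrow> W.vge ((p - 1) * (t + e)) (- of_nat (q * wt x))" for x
  proof -
    have "p ^ t dvd wt x \<longleftrightarrow> p ^ (t + e) dvd q * wt x"
      using p0 by (simp add: q_def power_add mult.commute)
    then show ?thesis by (simp only: W_vge_of_nat_iff W.vge_uminus_iff)
  qed
  show ?thesis
  proof
    assume "\<forall>x. p ^ t dvd wt x"
    then have *: "W.vge ((p - 1) * (t + e)) (- of_nat (q * wt x))" for x using iff by blast
    show "\<forall>r\<in>\<Omega>. W.vge ((p - 1) * (t + e)) (B r)"
    proof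
      fix r assume "r \<in> \<Omega>"
      show "W.vge ((p - 1) * (t + e)) (B r)"
        unfolding coefficient_inversion[OF \<open>r \<in> \<Omega>\<close>]
        by (intro W.vge_sum W.vge_mult_left W.vge_prod_0 D_vge *)
    qed
  next
    assume *: "\<forall>r\<in>\<Omega>. W.vge ((p - 1) * (t + e)) (B r)"
    have "W.vge ((p - 1) * (t + e)) (- of_nat (q * wt x))" for x
      unfolding weight_expansion
    proof (rule W.vge_sum)
      fix r assume "r \<in> \<Omega>"
      have "W.vge 0 (\<Prod>i<k. T (x i) ^ r i)"
        by (intro W.vge_0I W_set.prod_mem W_set.power_mem T_W)
      then show "W.vge ((p - 1) * (t + e)) (B r * (\<Prod>i<k. T (x i) ^ r i))"
        unfolding mult.commute[of "B r"] using * \<open>r \<in> \<Omega>\<close> by (intro W.vge_mult_left) auto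
    qed
    then show "\<forall>x. p ^ t dvd wt x" using iff by blast
  qed
qed

end

section \<open>From thresholds to the minimum\<close>

text \<open>Integrality of the values closes the gap: if the supremum s were below the infimum, the
  next integer after s would still bound every value from below. \<open>P 0\<close> makes s
  nonnegative, so that this integer is a natural number.\<close>

lemma SUP_nat_eq_INF:
  fixes X :: "'i \<Rightarrow> ereal"
  assumes P: "\<And>t. P t \<longleftrightarrow> (\<forall>r\<in>I. ereal (real t) \<le> X r)" and "P 0"
    and int: "\<And>r. r \<in> I \<Longrightarrow> X r = \<infinity> \<or> (\<exists>z::int. X r = ereal (of_int z))"
  shows "(SUP t\<in>{t. P t}. ereal (real t)) = (INF r\<in>I. X r)"
proof (rule antisym)
  show "(SUP t\<in>{t. P t}. ereal (real t)) \<le> (INF r\<in>I. X r)"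
    using P by (auto intro!: SUP_least INF_greatest)
  show "(INF r\<in>I. X r) \<le> (SUP t\<in>{t. P t}. ereal (real t))" (is "?inf \<le> ?sup")
  proof (rule ccontr)
    assume "\<not> ?inf \<le> ?sup"
    then have lt: "?sup < ?inf" by simp
    have "ereal (real 0) \<le> ?sup" by (rule SUP_upper) (use \<open>P 0\<close> in simp)
    then obtain s where s: "?sup = ereal s" "s \<ge> 0" using lt by (cases ?sup) auto
    define t where "t = nat (\<lfloor>s\<rfloor> + 1)"
    have t: "int t = \<lfloor>s\<rfloor> + 1" using s by (simp add: t_def)
    have "ereal (real t) \<le> X r" if r: "r \<in> I" for r
    proof -
      have "ereal s < X r" using lt s INF_lower[OF r, of X] by simp
      then show ?thesis
      proof (cases "X r = \<infinity>")
        case False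
        then obtain z :: int where z: "X r = ereal (of_int z)" using int[OF r] by blast
        then have "s < of_int z" using \<open>ereal s < X r\<close> by simp
        then have "int t \<le> z" unfolding t by linarith
        then show ?thesis unfolding z by simp
      qed simp
    qed
    then have "P t" unfolding P by blast
    then have "ereal (real t) \<le> ?sup" by (intro SUP_upper) simp
    then have "real t \<le> s" unfolding s by simp
    then show False using t by linarith
  qed
qed

lemma (in uniformized) SUP_veq: "veq t x \<Longrightarrow> (SUP n\<in>{n. vge n x}. ereal (real n)) = ereal (real t)"
  by (rule antisym) (auto simp: veq_vge_iff intro!: SUP_least SUP_upper)

context trace_code_setup
begin

definition I where
  "I = {r::nat \<Rightarrow> nat. (\<forall>i<k. r i \<le> N) \<and> (\<forall>i\<ge>k. r i = 0) \<and> q - 1 dvd (\<Sum>i<k. r i) \<and> (\<Sum>i<k. r i) > 0}"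

definition X where
  "X r = ereal ((\<Sum>i<k. real (digit_sum p (r i))) / real (p - 1)) + nu p N \<phi> (\<Gamma> r) - ereal (real e)"

lemma B_cong: "(\<And>i. i < k \<Longrightarrow> r i = s i) \<Longrightarrow> B r = B s"
  unfolding B_def \<Gamma>_def by simp

text \<open>The vectors in \<Omega> are undefined outside the index range and those in
  \<open>I\<close> are 0 there, but \<open>B\<close> sees only the range. Every vector of \<Omega>
  without a counterpart in \<open>I\<close> has \<open>B r = 0\<close>.\<close>

lemma vge_B_Omega_iff: "(\<forall>r\<in>\<Omega>. W.vge t (B r)) \<longleftrightarrow> (\<forall>r\<in>I. W.vge t (B r))"
proof (intro iffI ballI)
  fix r assume *: "\<forall>r\<in>\<Omega>. W.vge t (B r)" and r: "r \<in> I"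
  have "B r = B (restrict r {..<k})" by (rule B_cong) simp
  moreover have "restrict r {..<k} \<in> \<Omega>" using r by (auto simp: \<Omega>_def I_def)
  ultimately show "W.vge t (B r)" using * by simp
next
  fix r assume *: "\<forall>r\<in>I. W.vge t (B r)" and r: "r \<in> \<Omega>"
  consider "(\<Sum>i<k. r i) = 0" | "(\<Sum>i<k. r i) > 0" "\<not> q - 1 dvd (\<Sum>i<k. r i)"
    | "(\<Sum>i<k. r i) > 0" "q - 1 dvd (\<Sum>i<k. r i)" by linarith
  then show "W.vge t (B r)"
  proof cases
    case 1
    then show ?thesis by (simp add: B_def)
  next
    case 2
    moreover have "A t = 0" if "t > 0" "\<not> q - 1 dvd t" for t
      unfolding A_def sum_T_subfield[OF q2 q_dvd] using that by simp
    ultimately have "A (\<Sum>i<k. r i) = 0" by blast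
    then show ?thesis by (simp add: B_def)
  next
    case 3
    define s where "s i = (if i < k then r i else 0)" for i
    have "s \<in> I" using 3 r by (auto simp: I_def s_def \<Omega>_def)
    moreover have "B r = B s" by (rule B_cong) (simp add: s_def)
    ultimately show ?thesis using * by simp
  qed
qed

text \<open>As p - 1 divides q - 1, which divides |r|, it divides the digit sum as well. The factor
  \<open>A\<close> is the local unit q - 1, so the \<open>C (r i)\<close> alone determine the value
  of c.\<close>

lemma veq_B_factor:
  assumes "r \<in> I"
  obtains c h where "B r = c * \<Gamma> r" "W.veq ((p - 1) * h) c" "(\<Sum>i<k. digit_sum p (r i)) = (p - 1) * h"
proof -
  have "[(\<Sum>i<k. digit_sum p (r i)) = (\<Sum>i<k. r i)] (mod (p - 1))"
    by (intro cong_sum digit_sum_cong p2)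
  moreover have "p - 1 dvd q - 1" unfolding q_def by (rule minus_one_dvd_power_minus_one)
  then have "p - 1 dvd (\<Sum>i<k. r i)" using assms dvd_trans unfolding I_def by blast
  ultimately have "p - 1 dvd (\<Sum>i<k. digit_sum p (r i))" by (simp add: cong_dvd_iff)
  then obtain h where h: "(\<Sum>i<k. digit_sum p (r i)) = (p - 1) * h" by blast
  have A: "A t = of_nat (q - 1)" if "t > 0" "q - 1 dvd t" for t
    unfolding A_def sum_T_subfield[OF q2 q_dvd] using that by simp
  have "A (\<Sum>i<k. r i) = of_nat (q - 1)" using assms unfolding I_def by (intro A) blast+
  moreover have "\<not> p dvd q - 1"
  proof
    assume "p dvd q - 1"
    moreover have "p dvd q" using e_pos by (simp add: q_def)
    ultimately have "p dvd 1" using q2 by (metis dvd_diffD1 one_le_numeral order_trans)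
    then show False using p2 by simp
  qed
  ultimately have "W.veq 0 (A (\<Sum>i<k. r i))"
    by (simp only:) (intro W.veq_0I, simp_all add: of_nat_eq_0_iff del: of_nat_diff)
  moreover have "W.veq (\<Sum>i<k. digit_sum p (r i)) (\<Prod>i<k. C (r i))"
    by (intro W.veq_prod veq_C) (use assms in \<open>auto simp: I_def\<close>)
  ultimately have "W.veq (0 + (p - 1) * h) (A (\<Sum>i<k. r i) * (\<Prod>i<k. C (r i)))"
    unfolding h by (rule W.veq_mult)
  moreover have "(\<Sum>i<k. r i) \<noteq> 0" using assms unfolding I_def by blast
  then have "B r = A (\<Sum>i<k. r i) * (\<Prod>i<k. C (r i)) * \<Gamma> r" unfolding B_def by (rule if_not_P)
  ultimately show ?thesis using h by (intro that[of "A (\<Sum>i<k. r i) * (\<Prod>i<k. C (r i))" h]) simp_all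
qed

text \<open>Dividing values by p - 1 turns the normalisation at \<pi> into that of
  \<open>nu\<close>. If \<Gamma> r is divisible by all powers of p, for instance if it is 0, both
  sides of the equivalence hold.\<close>

lemma vge_B_iff:
  assumes "r \<in> I"
  shows "X r = \<infinity> \<or> (\<exists>z::int. X r = ereal (of_int z))" (is ?A)
    and "W.vge ((p - 1) * (t + e)) (B r) \<longleftrightarrow> ereal (real t) \<le> X r" (is ?B)
proof -
  obtain c h where ch: "B r = c * \<Gamma> r" "W.veq ((p - 1) * h) c"
    "(\<Sum>i<k. digit_sum p (r i)) = (p - 1) * h" using veq_B_factor[OF assms] .
  have "(\<Sum>i<k. real (digit_sum p (r i))) = real ((p - 1) * h)" unfolding ch(3)[symmetric] by simp
  then have X: "X r = ereal (real h) + nu p N \<phi> (\<Gamma> r) - ereal (real e)"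
    unfolding X_def using p2 by simp
  have "\<Gamma> r \<in> Zring N"
    unfolding \<Gamma>_def by (intro R.sum_mem R.prod_mem R.power_mem T_mem)
  then consider u where "R.veq u (\<Gamma> r)" | "\<forall>u. R.vge u (\<Gamma> r)"
    using R.veq_or_vge_all R.vge_0I by blast
  then have "?A \<and> ?B"
  proof cases
    case 1
    then have nu: "nu p N \<phi> (\<Gamma> r) = ereal (real u)" unfolding nu_eq by (rule R.SUP_veq)
    have "W.veq ((p - 1) * h + (p - 1) * u) (B r)"
      unfolding ch(1) by (intro W.veq_mult W_veq_Zring 1 ch)
    then have "W.vge ((p - 1) * (t + e)) (B r) \<longleftrightarrow> (p - 1) * (t + e) \<le> (p - 1) * h + (p - 1) * u"
      by (rule W.veq_vge_iff)
    also have "\<dots> \<longleftrightarrow> t + e \<le> h + u" using p2 by (simp flip: distrib_left)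
    finally have "W.vge ((p - 1) * (t + e)) (B r) \<longleftrightarrow> t + e \<le> h + u" .
    moreover have Xr: "X r = ereal (of_int (int h + int u - int e))" unfolding X nu by simp
    moreover have "ereal (real t) \<le> X r \<longleftrightarrow> t + e \<le> h + u"
      unfolding X nu by simp linarith
    ultimately show ?thesis by blast
  next
    case 2
    then have "nu p N \<phi> (\<Gamma> r) = \<infinity>" unfolding nu_eq by (simp add: SUP_nat_Infty)
    then have "X r = \<infinity>" unfolding X by simp
    moreover have "W.vge ((p - 1) * (t + e)) (B r)"
      unfolding ch(1) using W_vge_Zring 2 W.veq_vge_iff[OF ch(2), of 0]
      by (intro W.vge_mult_left) auto
    ultimately show ?thesis by simp
  qed
  then show ?A ?B by blast+
qed

lemma code_val_eq_SUP:
  "code_val p n (trace_code q m n (lin_code k n G)) = (SUP t\<in>{t. \<forall>x. p ^ t dvd wt x}. ereal (real t))"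
proof -
  have "(\<forall>c\<in>trace_code q m n (lin_code k n G). p ^ t dvd hweight n c) \<longleftrightarrow> (\<forall>x. p ^ t dvd wt x)" for t
  proof -
    have "trace_code q m n (lin_code k n G) = range (\<lambda>x j. if j < n then trace q m (cword x j) else 0)"
      unfolding trace_code_def lin_code_def cword_def
    proof (intro equalityI subsetI)
      fix c assume "c \<in> range (\<lambda>x j. if j < n then trace q m (\<Sum>i<k. x i * G i j) else 0)"
      then obtain x where x: "c = (\<lambda>j. if j < n then trace q m (\<Sum>i<k. x i * G i j) else 0)" by blast
      show "c \<in> (\<lambda>c j. if j < n then trace q m (c j) else 0) `
          {c. \<exists>x. \<forall>j. c j = (if j < n then \<Sum>i<k. x i * G i j else 0)}"
        by (rule image_eqI[of _ _ "\<lambda>j. if j < n then \<Sum>i<k. x i * G i j else 0"]) (auto simp: x)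
    qed fastforce
    moreover have "hweight n (\<lambda>j. if j < n then trace q m (cword x j) else 0) = wt x" for x
      unfolding hweight_def wt_def by (rule arg_cong[of _ _ card]) auto
    ultimately show ?thesis by simp
  qed
  then show ?thesis unfolding code_val_def by simp
qed

lemma code_val_eq_INF: "code_val p n (trace_code q m n (lin_code k n G)) = (INF r\<in>I. X r)"
  unfolding code_val_eq_SUP
proof (rule SUP_nat_eq_INF)
  show "(\<forall>x. p ^ t dvd wt x) \<longleftrightarrow> (\<forall>r\<in>I. ereal (real t) \<le> X r)" for t
    unfolding vge_weights_iff vge_B_Omega_iff by (intro ball_cong vge_B_iff refl)
  show "X r = \<infinity> \<or> (\<exists>z::int. X r = ereal (of_int z))" if "r \<in> I" for r
    using that by (rule vge_B_iff(1))
qed simp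

end

theorem theorem3p2:
  fixes p e m n k :: nat
    and G :: "nat \<Rightarrow> nat \<Rightarrow> 'a::{field,finite}"
    and \<phi> :: "complex \<Rightarrow> 'a"
  assumes "prime p" and "e \<ge> 1" and "m \<ge> 1"
    and "CARD('a) = (p ^ e) ^ m"
    and "\<forall>x. (\<forall>j<n. (\<Sum>i<k. x i * G i j) = 0) \<longrightarrow> (\<forall>i<k. x i = 0)"
    and "residue_map (CARD('a) - 1) \<phi>"
  shows "code_val p n (trace_code (p ^ e) m n (lin_code k n G)) =
    (INF r \<in> {r::nat \<Rightarrow> nat. (\<forall>i<k. r i \<le> (p ^ e) ^ m - 1) \<and> (\<forall>i\<ge>k. r i = 0)
                 \<and> (p ^ e - 1) dvd (\<Sum>i<k. r i) \<and> (\<Sum>i<k. r i) > 0}.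
       ereal ((\<Sum>i<k. real (digit_sum p (r i))) / real (p - 1))
       + nu p (CARD('a) - 1) \<phi>
           (\<Sum>j<n. \<Prod>i<k. teich (CARD('a) - 1) \<phi> (G i j) ^ r i)
       - ereal (real e))"
proof -
  interpret trace_code_setup p "e * m" "CARD('a) - 1" \<phi> e m n k "p ^ e" G
    using assms by unfold_locales (auto simp: power_mult)
  show ?thesis
    using code_val_eq_INF[unfolded I_def X_def[abs_def] \<Gamma>_def T_def] unfolding assms(4) .
qed

end
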